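(* Let $\mu\in\mathcal{P}_2(\mathbb{R}^d)$ be absolutely continuous with respect to Lebesgue measure. Let $\varrho:L^2_d\to\mathbb{R}$ be a lower semicontinuous functional which is convex, law invariant (that is, $\varrho(X)=\varrho(Y)$ whenever $X\sim Y$) and $\mu$-comonotonic additive (that is, $\varrho(X+Y)=\varrho(X)+\varrho(Y)$ whenever $X,Y\in L^2_d$ are $\mu$-comonotonic). Then $\varrho$ is strongly coherent. Equivalently, $\varrho$ is a maximal correlation risk measure, namely there exists $\nu\in\mathcal{P}_2(\mathbb{R}^d)$ such that $\varrho=\varrho_\nu$, and $\mu$ and $\nu$ are related by a location-scale transformation, that is $\nu=T\#\mu$ where $T(u)=\lambda u+u_0$ with $\lambda>0$ and $u_0\in\mathbb{R}^d$.
   Context: $(\Omega,\mathcal{F},\mathbb{P})$ is a nonatomic probability space such that $L^2(\Omega,\mathcal{F},\mathbb{P})$ is separable. $L^2_d$ is the space of (a.s. equivalence classes of) $\mathcal{F}$-measurable random vectors $X:\Omega\to\mathbb{R}^d$ with $\mathbb{E}|X|^2<\infty$. $X\sim Y$ means equality in distribution; $X\sim\mu$ means $X$ has distribution $\mu$. $\mathcal{P}_2(\mathbb{R}^d)$ is the set of Borel probability measures on $\mathbb{R}^d$ with finite second moment. $T\#\mu$ is the push-forward of $\mu$ by $T$. $\mu$-comonotonicity: $X,Y\in L^2_d$ are $\mu$-comonotonic if there is a random vector $U\sim\mu$ such that $U\in\operatorname{argmax}_{\tilde U}\{\mathbb{E}[X\cdot\tilde U]:\tilde U\sim\mu\}$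 and $U\in\operatorname{argmax}_{\tilde U}\{\mathbb{E}[Y\cdot\tilde U]:\tilde U\sim\mu\}$. Strongly coherent risk measure: a functional $\varrho:L^2_d\to\mathbb{R}$ that is convex and continuous and satisfies, for all $X,Y\in L^2_d$, $\varrho(X)+\varrho(Y)=\sup\{\varrho(\tilde X+\tilde Y):\tilde X\sim X,\ \tilde Y\sim Y\}$. Maximal correlation risk measure with baseline $\nu\in\mathcal{P}_2(\mathbb{R}^d)$: $\varrho_\nu(X)=\sup\{\mathbb{E}[X\cdot\tilde U]:\tilde U\sim\nu\}$.
   Formalization: The location-scale relation ν = T#μ with λ > 0 is claimed only for d ≥ 2 and ϱ not of the form X ↦ E[X·u]; it is false for such ϱ (e.g. ϱ = 0, where ν is a Dirac mass) and for d = 1 (any ϱ_ν is μ-comonotonic additive there). *)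

theory Defs
  imports "HOL-Probability.Probability"
begin

definition nonatomic :: "'w measure \<Rightarrow> bool" where
  "nonatomic M \<longleftrightarrow>
     (\<forall>A\<in>sets M. 0 < measure M A \<longrightarrow>
        (\<exists>B\<in>sets M. B \<subseteq> A \<and> 0 < measure M B \<and> measure M B < measure M A))"

text \<open>Elements of \<open>L2\<close> are functions rather than almost sure equivalence classes, so
  \<open>L2_dist\<close> is only a pseudometric. Law-invariant functionals, and functionals that are
  continuous for \<open>L2_dist\<close>, are constant on the classes.\<close>

definition L2 :: "'w measure \<Rightarrow> ('w \<Rightarrow> 'b::euclidean_space) set" where
  "L2 M = {X \<in> borel_measurable M. integrable M (\<lambda>\<omega>. (norm (X \<omega>))\<^sup>2)}"

definition L2_dist :: "'w measure \<Rightarrow> ('w \<Rightarrow> 'b::euclidean_space) \<Rightarrow> ('w \<Rightarrow> 'b) \<Rightarrow> real" where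
  "L2_dist M X Y = sqrt (\<integral>\<omega>. (norm (X \<omega> - Y \<omega>))\<^sup>2 \<partial>M)"

definition L2_separable :: "'w measure \<Rightarrow> bool" where
  "L2_separable M \<longleftrightarrow>
     (\<exists>D :: ('w \<Rightarrow> real) set. countable D \<and> D \<subseteq> L2 M \<and>
        (\<forall>X\<in>L2 M. \<forall>e>0. \<exists>Y\<in>D. L2_dist M X Y < e))"

definition P2 :: "'b::euclidean_space measure set" where
  "P2 = {\<mu>. prob_space \<mu> \<and> sets \<mu> = sets borel \<and> integrable \<mu> (\<lambda>x. (norm x)\<^sup>2)}"

definition has_law :: "'w measure \<Rightarrow> ('w \<Rightarrow> 'b::euclidean_space) \<Rightarrow> 'b measure \<Rightarrow> bool" where
  "has_law M X \<mu> \<longleftrightarrow> X \<in> borel_measurable M \<and> distr M borel X = \<mu>"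

definition same_law ::
    "'w measure \<Rightarrow> ('w \<Rightarrow> 'b::euclidean_space) \<Rightarrow> ('w \<Rightarrow> 'b) \<Rightarrow> bool" where
  "same_law M X Y \<longleftrightarrow> X \<in> borel_measurable M \<and> Y \<in> borel_measurable M \<and>
     distr M borel X = distr M borel Y"

definition correlation ::
    "'w measure \<Rightarrow> ('w \<Rightarrow> 'b::euclidean_space) \<Rightarrow> ('w \<Rightarrow> 'b) \<Rightarrow> real" where
  "correlation M X U = (\<integral>\<omega>. X \<omega> \<bullet> U \<omega> \<partial>M)"

definition comonotonic ::
    "'w measure \<Rightarrow> 'b::euclidean_space measure \<Rightarrow> ('w \<Rightarrow> 'b) \<Rightarrow> ('w \<Rightarrow> 'b) \<Rightarrow> bool" where
  "comonotonic M \<mu> X Y \<longleftrightarrow>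
     (\<exists>U. is_arg_max (correlation M X) (\<lambda>V. has_law M V \<mu>) U \<and>
          is_arg_max (correlation M Y) (\<lambda>V. has_law M V \<mu>) U)"

definition convex_functional :: "'w measure \<Rightarrow> (('w \<Rightarrow> 'b::euclidean_space) \<Rightarrow> real) \<Rightarrow> bool" where
  "convex_functional M \<rho> \<longleftrightarrow>
     (\<forall>X\<in>L2 M. \<forall>Y\<in>L2 M. \<forall>t\<in>{0..1}.
        \<rho> (\<lambda>\<omega>. t *\<^sub>R X \<omega> + (1 - t) *\<^sub>R Y \<omega>) \<le> t * \<rho> X + (1 - t) * \<rho> Y)"

definition continuous_functional ::
    "'w measure \<Rightarrow> (('w \<Rightarrow> 'b::euclidean_space) \<Rightarrow> real) \<Rightarrow> bool" where
  "continuous_functional M \<rho> \<longleftrightarrow>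
     (\<forall>X\<in>L2 M. \<forall>e>0. \<exists>\<delta>>0. \<forall>Y\<in>L2 M. L2_dist M X Y < \<delta> \<longrightarrow> \<bar>\<rho> Y - \<rho> X\<bar> < e)"

definition lsc_functional :: "'w measure \<Rightarrow> (('w \<Rightarrow> 'b::euclidean_space) \<Rightarrow> real) \<Rightarrow> bool" where
  "lsc_functional M \<rho> \<longleftrightarrow>
     (\<forall>X\<in>L2 M. \<forall>e>0. \<exists>\<delta>>0. \<forall>Y\<in>L2 M. L2_dist M X Y < \<delta> \<longrightarrow> \<rho> X - e < \<rho> Y)"

definition law_invariant :: "'w measure \<Rightarrow> (('w \<Rightarrow> 'b::euclidean_space) \<Rightarrow> real) \<Rightarrow> bool" where
  "law_invariant M \<rho> \<longleftrightarrow> (\<forall>X\<in>L2 M. \<forall>Y\<in>L2 M. same_law M X Y \<longrightarrow> \<rho> X = \<rho> Y)"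

definition comonotonic_additive ::
    "'w measure \<Rightarrow> 'b::euclidean_space measure \<Rightarrow> (('w \<Rightarrow> 'b) \<Rightarrow> real) \<Rightarrow> bool" where
  "comonotonic_additive M \<mu> \<rho> \<longleftrightarrow>
     (\<forall>X\<in>L2 M. \<forall>Y\<in>L2 M. comonotonic M \<mu> X Y \<longrightarrow> \<rho> (\<lambda>\<omega>. X \<omega> + Y \<omega>) = \<rho> X + \<rho> Y)"

text \<open>The suprema below are taken in \<^typ>\<open>ereal\<close>: on \<^typ>\<open>real\<close>, \<^const>\<open>Sup\<close> of an
  unbounded or empty set is unspecified.\<close>

definition strongly_coherent :: "'w measure \<Rightarrow> (('w \<Rightarrow> 'b::euclidean_space) \<Rightarrow> real) \<Rightarrow> bool" where
  "strongly_coherent M \<rho> \<longleftrightarrow>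
     convex_functional M \<rho> \<and> continuous_functional M \<rho> \<and>
     (\<forall>X\<in>L2 M. \<forall>Y\<in>L2 M.
        ereal (\<rho> X + \<rho> Y) =
          Sup {ereal (\<rho> (\<lambda>\<omega>. X' \<omega> + Y' \<omega>)) | X' Y'. same_law M X' X \<and> same_law M Y' Y})"

definition max_correlation ::
    "'w measure \<Rightarrow> 'b::euclidean_space measure \<Rightarrow> ('w \<Rightarrow> 'b) \<Rightarrow> ereal" where
  "max_correlation M \<nu> X = Sup {ereal (correlation M X U) | U. has_law M U \<nu>}"

text \<open>The maximal correlation risk measures whose baseline is a Dirac measure.\<close>

definition expectation_functional ::
    "'w measure \<Rightarrow> (('w \<Rightarrow> 'b::euclidean_space) \<Rightarrow> real) \<Rightarrow> bool" where
  "expectation_functional M \<rho> \<longleftrightarrow> (\<exists>u. \<forall>X\<in>L2 M. \<rho> X = (\<integral>\<omega>. X \<omega> \<bullet> u \<partial>M))"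

end

theory Submission
  imports Defs
begin

text \<open>Fix \<open>U \<sim> \<mu>\<close>. The random vectors for which \<open>U\<close> is an optimal coupling form a convex cone on
  which \<open>\<rho>\<close> is additive, and by semidiscrete optimal transport every simple random vector has the
  law of an element of this cone. Law invariance and density therefore make \<open>\<rho>\<close> sublinear, and
  additivity on the cone yields a subgradient \<open>V\<close> of \<open>\<rho>\<close> at \<open>0\<close> with \<open>\<rho> k = E[k \<bullet> V]\<close> for all \<open>k\<close>
  in the cone. On a nonatomic space the couplings of \<open>X\<close> with the law of \<open>V\<close> can be realised
  approximately by moving either marginal, so \<open>\<rho>\<close> is the maximal correlation risk measure of the
  law of \<open>V\<close>. Applied to \<open>k = 1{e \<bullet> U > c} e\<close>, optimality says that each half-space
  \<open>{e \<bullet> U > c}\<close> is an upper level set of \<open>e \<bullet> V\<close>. Hence \<open>V \<omega> - V \<omega>'\<close> is a nonnegative multiple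
  of \<open>U \<omega> - U \<omega>'\<close> for almost all \<open>\<omega>, \<omega>'\<close>, and comparing three points shows that in dimension
  at least two the factor is constant.\<close>

section \<open>The space of square integrable random vectors\<close>

text \<open>The location-scale relation is claimed only in dimension at least two and away from
  expectation functionals. In dimension one every maximal correlation risk measure is additive on
  pairs that are comonotonic for an atomless \<open>\<mu>\<close>, so nothing ties
  \<open>\<nu>\<close> to \<open>\<mu>\<close>. A Dirac baseline gives a linear functional, additive
  in every dimension, whose scale factor is 0 instead of positive. Couplings are realised only
  approximately because a random vector may generate the whole sigma-algebra, which leaves no
  randomness for a partner with prescribed joint law. Rounding one marginal to countably many values
  makes room for the partner. Absolute continuity enters through the nullity of hyperplanes:
  boundaries of transport cells become null, and almost every point is in general position for the
  three-point comparison.\<close>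

abbreviation L2_norm :: "'w measure \<Rightarrow> ('w \<Rightarrow> 'b::euclidean_space) \<Rightarrow> real" where
  "L2_norm M X \<equiv> L2_dist M X (\<lambda>_. 0)"

lemma L2_borel [measurable_dest]: "X \<in> L2 M \<Longrightarrow> X \<in> borel_measurable M"
  by (simp add: L2_def)

lemma L2_integrable_inner:
  assumes "X \<in> L2 M" "Y \<in> L2 M"
  shows "integrable M (\<lambda>\<omega>. X \<omega> \<bullet> Y \<omega>)"
proof (rule Bochner_Integration.integrable_bound)
  show "integrable M (\<lambda>\<omega>. (norm (X \<omega>))\<^sup>2 + (norm (Y \<omega>))\<^sup>2)"
    using assms by (auto simp: L2_def)
  show "(\<lambda>\<omega>. X \<omega> \<bullet> Y \<omega>) \<in> borel_measurable M"
    using assms by (auto simp: L2_def)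
  show "AE \<omega> in M. norm (X \<omega> \<bullet> Y \<omega>) \<le> norm ((norm (X \<omega>))\<^sup>2 + (norm (Y \<omega>))\<^sup>2)"
  proof (rule AE_I2)
    fix \<omega>
    have "\<bar>X \<omega> \<bullet> Y \<omega>\<bar> \<le> norm (X \<omega>) * norm (Y \<omega>)"
      by (rule Cauchy_Schwarz_ineq2)
    also have "\<dots> \<le> (norm (X \<omega>))\<^sup>2 + (norm (Y \<omega>))\<^sup>2"
      using sum_squares_bound[of "norm (X \<omega>)" "norm (Y \<omega>)"]
        mult_nonneg_nonneg[OF norm_ge_zero norm_ge_zero, of "X \<omega>" "Y \<omega>"] by linarith
    finally show "norm (X \<omega> \<bullet> Y \<omega>) \<le> norm ((norm (X \<omega>))\<^sup>2 + (norm (Y \<omega>))\<^sup>2)"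
      by simp
  qed
qed

lemma L2_add:
  assumes "X \<in> L2 M" "Y \<in> L2 M"
  shows "(\<lambda>\<omega>. X \<omega> + Y \<omega>) \<in> L2 M"
proof -
  have "integrable M (\<lambda>\<omega>. X \<omega> \<bullet> X \<omega> + 2 * (X \<omega> \<bullet> Y \<omega>) + Y \<omega> \<bullet> Y \<omega>)"
    using assms by (intro Bochner_Integration.integrable_add integrable_mult_right L2_integrable_inner)
  moreover have "(\<lambda>\<omega>. X \<omega> \<bullet> X \<omega> + 2 * (X \<omega> \<bullet> Y \<omega>) + Y \<omega> \<bullet> Y \<omega>) = (\<lambda>\<omega>. (norm (X \<omega> + Y \<omega>))\<^sup>2)"
    by (simp add: power2_norm_eq_inner inner_simps inner_commute algebra_simps)
  ultimately show ?thesis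
    using assms by (auto simp: L2_def)
qed

lemma L2_scaleR:
  assumes "X \<in> L2 M"
  shows "(\<lambda>\<omega>. c *\<^sub>R X \<omega>) \<in> L2 M"
  using assms by (auto simp: L2_def power_mult_distrib)

lemma L2_uminus:
  assumes "X \<in> L2 M"
  shows "(\<lambda>\<omega>. - X \<omega>) \<in> L2 M"
  using assms by (auto simp: L2_def)

lemma L2_diff:
  assumes "X \<in> L2 M" "Y \<in> L2 M"
  shows "(\<lambda>\<omega>. X \<omega> - Y \<omega>) \<in> L2 M"
  using L2_add[OF assms(1) L2_uminus[OF assms(2)]] by simp

lemma L2_zero: "(\<lambda>_. 0) \<in> L2 M"
  by (simp add: L2_def)

lemma (in prob_space) L2_bounded:
  assumes "X \<in> borel_measurable M" and "\<And>\<omega>. \<omega> \<in> space M \<Longrightarrow> norm (X \<omega>) \<le> B"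
  shows "X \<in> L2 M"
proof -
  have "integrable M (\<lambda>\<omega>. (norm (X \<omega>))\<^sup>2)"
    using assms by (intro integrable_const_bound[of _ "B\<^sup>2"]) (auto intro!: AE_I2 power_mono)
  then show ?thesis using assms by (simp add: L2_def)
qed

lemmas L2_intros = L2_add L2_scaleR L2_uminus L2_diff L2_zero

lemma correlation_commute: "correlation M X Y = correlation M Y X"
  by (simp add: correlation_def inner_commute)

lemma correlation_add_left:
  assumes "X \<in> L2 M" "Y \<in> L2 M" "Z \<in> L2 M"
  shows "correlation M (\<lambda>\<omega>. X \<omega> + Y \<omega>) Z = correlation M X Z + correlation M Y Z"
  using assms by (simp add: correlation_def inner_add_left L2_integrable_inner)

lemma correlation_diff_left:
  assumes "X \<in> L2 M" "Y \<in> L2 M" "Z \<in> L2 M"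
  shows "correlation M (\<lambda>\<omega>. X \<omega> - Y \<omega>) Z = correlation M X Z - correlation M Y Z"
  using assms by (simp add: correlation_def inner_diff_left L2_integrable_inner)

lemma correlation_scaleR_left:
  "correlation M (\<lambda>\<omega>. c *\<^sub>R X \<omega>) Z = c * correlation M X Z"
  by (simp add: correlation_def)

lemma correlation_uminus_left:
  "correlation M (\<lambda>\<omega>. - X \<omega>) Z = - correlation M X Z"
  by (simp add: correlation_def)

lemma correlation_add_right:
  assumes "X \<in> L2 M" "Y \<in> L2 M" "Z \<in> L2 M"
  shows "correlation M Z (\<lambda>\<omega>. X \<omega> + Y \<omega>) = correlation M Z X + correlation M Z Y"
  using assms by (simp add: correlation_def inner_add_right L2_integrable_inner)

lemma correlation_diff_right:
  assumes "X \<in> L2 M" "Y \<in> L2 M" "Z \<in> L2 M"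
  shows "correlation M Z (\<lambda>\<omega>. X \<omega> - Y \<omega>) = correlation M Z X - correlation M Z Y"
  using assms by (simp add: correlation_def inner_diff_right L2_integrable_inner)

lemma correlation_scaleR_right:
  "correlation M Z (\<lambda>\<omega>. c *\<^sub>R X \<omega>) = c * correlation M Z X"
  by (simp add: correlation_def)

lemma correlation_uminus_right:
  "correlation M Z (\<lambda>\<omega>. - X \<omega>) = - correlation M Z X"
  by (simp add: correlation_def)

lemmas correlation_simps =
  correlation_add_left correlation_diff_left correlation_scaleR_left correlation_uminus_left
  correlation_add_right correlation_diff_right correlation_scaleR_right correlation_uminus_right

lemma correlation_self_nonneg: "0 \<le> correlation M X X"
  by (simp add: correlation_def)

lemma L2_norm_square: "(L2_norm M X)\<^sup>2 = correlation M X X"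
  by (simp add: L2_dist_def correlation_def power2_norm_eq_inner)

lemma L2_dist_eq_norm: "L2_dist M X Y = L2_norm M (\<lambda>\<omega>. X \<omega> - Y \<omega>)"
  by (simp add: L2_dist_def)

lemma L2_dist_nonneg [simp]: "0 \<le> L2_dist M X Y"
  by (simp add: L2_dist_def)

lemma L2_dist_commute: "L2_dist M X Y = L2_dist M Y X"
  by (simp add: L2_dist_def norm_minus_commute)

lemma L2_dist_self [simp]: "L2_dist M X X = 0"
  by (simp add: L2_dist_def)

lemma L2_norm_scaleR: "L2_norm M (\<lambda>\<omega>. c *\<^sub>R X \<omega>) = \<bar>c\<bar> * L2_norm M X"
  by (simp add: L2_dist_def power_mult_distrib real_sqrt_mult)

lemma L2_norm_uminus: "L2_norm M (\<lambda>\<omega>. - X \<omega>) = L2_norm M X"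
  by (simp add: L2_dist_def)

lemma correlation_Cauchy_Schwarz:
  assumes X: "X \<in> L2 M" and Y: "Y \<in> L2 M"
  shows "\<bar>correlation M X Y\<bar> \<le> L2_norm M X * L2_norm M Y"
proof -
  have nonneg: "0 \<le> s\<^sup>2 * correlation M X X - 2 * s * t * correlation M X Y + t\<^sup>2 * correlation M Y Y" for s t
  proof -
    have "0 \<le> correlation M (\<lambda>\<omega>. s *\<^sub>R X \<omega> - t *\<^sub>R Y \<omega>) (\<lambda>\<omega>. s *\<^sub>R X \<omega> - t *\<^sub>R Y \<omega>)"
      by (rule correlation_self_nonneg)
    also have "\<dots> = s\<^sup>2 * correlation M X X - 2 * s * t * correlation M X Y + t\<^sup>2 * correlation M Y Y"
      using X Y by (simp add: correlation_simps L2_intros correlation_commute[of M Y X] power2_eq_square algebra_simps)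
    finally show ?thesis .
  qed
  have "(correlation M X Y)\<^sup>2 \<le> correlation M X X * correlation M Y Y"
  proof (cases "correlation M X X = 0")
    case True
    have "correlation M X Y = 0"
    proof (rule ccontr)
      assume ne: "correlation M X Y \<noteq> 0"
      \<comment> \<open>The form is affine in \<open>s\<close> when
        \<open>correlation M X X = 0\<close>; this \<open>s\<close> makes its value
        \<open>-1\<close>.\<close>
      have "0 \<le> correlation M Y Y - 2 * ((correlation M Y Y + 1) / (2 * correlation M X Y)) * correlation M X Y"
        using nonneg[of "(correlation M Y Y + 1) / (2 * correlation M X Y)" 1] True by simp
      then show False using ne by (simp add: field_simps)
    qed
    then show ?thesis using True by simp
  next
    case False
    then have pos: "0 < correlation M X X"
      using correlation_self_nonneg[of M X] by simp
    have "0 \<le> correlation M X X * (correlation M X X * correlation M Y Y - (correlation M X Y)\<^sup>2)"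
      using nonneg[of "correlation M X Y" "correlation M X X"] by (simp add: power2_eq_square algebra_simps)
    then show ?thesis using pos by (simp add: zero_le_mult_iff)
  qed
  then have "\<bar>correlation M X Y\<bar> \<le> sqrt (correlation M X X * correlation M Y Y)"
    by (simp add: real_le_rsqrt)
  then show ?thesis
    by (simp add: L2_dist_def correlation_def real_sqrt_mult power2_norm_eq_inner)
qed

lemma L2_norm_triangle:
  assumes X: "X \<in> L2 M" and Y: "Y \<in> L2 M"
  shows "L2_norm M (\<lambda>\<omega>. X \<omega> + Y \<omega>) \<le> L2_norm M X + L2_norm M Y"
proof (rule power2_le_imp_le)
  have "(L2_norm M (\<lambda>\<omega>. X \<omega> + Y \<omega>))\<^sup>2 = (L2_norm M X)\<^sup>2 + 2 * correlation M X Y + (L2_norm M Y)\<^sup>2"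
    using X Y unfolding L2_norm_square
    by (simp add: correlation_simps L2_intros correlation_commute[of M Y X])
  also have "\<dots> \<le> (L2_norm M X + L2_norm M Y)\<^sup>2"
    using correlation_Cauchy_Schwarz[OF X Y] by (simp add: power2_sum abs_le_iff)
  finally show "(L2_norm M (\<lambda>\<omega>. X \<omega> + Y \<omega>))\<^sup>2 \<le> (L2_norm M X + L2_norm M Y)\<^sup>2" .
qed simp

lemma L2_dist_triangle:
  assumes "X \<in> L2 M" "Y \<in> L2 M" "Z \<in> L2 M"
  shows "L2_dist M X Z \<le> L2_dist M X Y + L2_dist M Y Z"
  using L2_norm_triangle[OF L2_diff[OF assms(1,2)] L2_diff[OF assms(2,3)]]
  by (simp add: L2_dist_def)

lemma L2_dist_add_cancel: "L2_dist M (\<lambda>\<omega>. X \<omega> + Y \<omega>) (\<lambda>\<omega>. X \<omega> + Z \<omega>) = L2_dist M Y Z"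
  by (simp add: L2_dist_def)

section \<open>Bounds in mean and completeness\<close>

lemma (in prob_space) expectation_norm_le_L2_norm:
  assumes X: "X \<in> L2 M"
  shows "integrable M (\<lambda>\<omega>. norm (X \<omega>))" and "expectation (\<lambda>\<omega>. norm (X \<omega>)) \<le> L2_norm M X"
proof -
  let ?Y = "\<lambda>\<omega>. norm (X \<omega>)"
  have Y: "?Y \<in> L2 M" using X by (auto simp: L2_def)
  have one: "(\<lambda>_. 1 :: real) \<in> L2 M" by (rule L2_bounded) auto
  show "integrable M ?Y" using L2_integrable_inner[OF Y one] by simp
  have "expectation ?Y \<le> L2_norm M ?Y * L2_norm M (\<lambda>_. 1 :: real)"
    using correlation_Cauchy_Schwarz[OF Y one] by (simp add: correlation_def)
  then show "expectation ?Y \<le> L2_norm M X"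
    by (simp add: L2_dist_def prob_space)
qed

lemma (in prob_space) L2_integrable:
  assumes "X \<in> L2 M"
  shows "integrable M X"
  using expectation_norm_le_L2_norm(1)[OF assms] assms
  by (simp add: L2_def integrable_norm_iff)

text \<open>The mean of the norm is at most the \<open>L2\<close> norm, so the increments are almost
  surely summable and the sequence converges pointwise; Fatou's lemma then bounds the distance to
  the limit. Both later uses build sequences with geometric steps, hence the form of
  \<open>step\<close>.\<close>

lemma (in prob_space) L2_complete:
  fixes X :: "nat \<Rightarrow> 'a \<Rightarrow> 'b::euclidean_space"
  assumes X: "\<And>n. X n \<in> L2 M" and step: "\<And>n. L2_dist M (X (Suc n)) (X n) \<le> (1/2)^n"
  obtains Y where "Y \<in> L2 M" and "\<And>n. L2_dist M (X n) Y \<le> 2 * (1/2)^n"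
proof -
  have [measurable]: "X n \<in> borel_measurable M" for n using X by (rule L2_borel)
  define D where "D n \<omega> = norm (X (Suc n) \<omega> - X n \<omega>)" for n \<omega>
  have [measurable]: "D n \<in> borel_measurable M" for n unfolding D_def by measurable
  have D: "integrable M (D n)" "expectation (D n) \<le> (1/2)^n" for n
    using expectation_norm_le_L2_norm[OF L2_diff[OF X[of "Suc n"] X[of n]]] step[of n]
    by (auto simp: D_def[abs_def] L2_dist_def)
  have "AE \<omega> in M. summable (\<lambda>n. D n \<omega>)"
  proof -
    have "(\<integral>\<^sup>+ \<omega>. (\<Sum>n. ennreal (D n \<omega>)) \<partial>M) = (\<Sum>n. \<integral>\<^sup>+ \<omega>. ennreal (D n \<omega>) \<partial>M)"
      by (rule nn_integral_suminf) measurable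
    also have "\<dots> = (\<Sum>n. ennreal (expectation (D n)))"
      by (intro suminf_cong nn_integral_eq_integral D) (auto simp: D_def)
    also have "\<dots> \<le> (\<Sum>n. ennreal ((1/2)^n))"
      by (intro suminf_le ennreal_leI D) auto
    also have "\<dots> = ennreal (\<Sum>n. (1/2)^n)"
      by (intro suminf_ennreal2) (auto intro: summable_geometric)
    also have "\<dots> < \<infinity>" by simp
    finally have "AE \<omega> in M. (\<Sum>n. ennreal (D n \<omega>)) \<noteq> \<infinity>"
      by (intro nn_integral_PInf_AE) auto
    then show ?thesis
      by (rule AE_mp) (auto intro!: AE_I2 summable_suminf_not_top simp: D_def)
  qed
  then have conv: "AE \<omega> in M. convergent (\<lambda>n. X n \<omega>)"
  proof (rule AE_mp, intro AE_I2 impI)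
    fix \<omega> assume "summable (\<lambda>n. D n \<omega>)"
    then have "summable (\<lambda>n. X (Suc n) \<omega> - X n \<omega>)"
      unfolding D_def by (rule summable_norm_cancel)
    then have "convergent (\<lambda>n. \<Sum>i<n. X (Suc i) \<omega> - X i \<omega>)"
      by (simp add: summable_iff_convergent)
    then have "convergent (\<lambda>n. X n \<omega> - X 0 \<omega>)"
      by (simp only: sum_lessThan_telescope[of "\<lambda>i. X i \<omega>"])
    then have "convergent (\<lambda>n. (X n \<omega> - X 0 \<omega>) + X 0 \<omega>)"
      by (rule convergent_add) (rule convergent_const)
    then show "convergent (\<lambda>n. X n \<omega>)" by simp
  qed
  define Y where "Y \<omega> = lim (\<lambda>n. X n \<omega>)" for \<omega>
  have [measurable]: "Y \<in> borel_measurable M" unfolding Y_def by measurable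
  have lim: "AE \<omega> in M. (\<lambda>n. X n \<omega>) \<longlonglongrightarrow> Y \<omega>"
    using conv by eventually_elim (simp add: Y_def convergent_LIMSEQ_iff)
  \<comment> \<open>Subtracting the tail \<open>2 * (1/2)^(n+k)\<close> lets the geometric sum pass
    through the induction.\<close>
  have dist_le: "L2_dist M (X (n + k)) (X n) \<le> 2 * (1/2)^n - 2 * (1/2)^(n+k)" for n k
  proof (induction k)
    case (Suc k)
    have "L2_dist M (X (n + Suc k)) (X n) \<le> L2_dist M (X (n + Suc k)) (X (n + k)) + L2_dist M (X (n + k)) (X n)"
      by (intro L2_dist_triangle X)
    moreover have "(1/2::real)^(n + Suc k) = (1/2)^(n + k) / 2" by simp
    moreover have "L2_dist M (X (n + Suc k)) (X (n + k)) \<le> (1/2)^(n + k)"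
      using step[of "n + k"] by simp
    ultimately show ?case using Suc by linarith
  qed simp
  have sq: "(\<integral>\<^sup>+ \<omega>. ennreal ((norm (X n \<omega> - Y \<omega>))\<^sup>2) \<partial>M) \<le> ennreal ((2 * (1/2)^n)\<^sup>2)" for n
  proof -
    have "(\<integral>\<^sup>+ \<omega>. ennreal ((norm (X n \<omega> - Y \<omega>))\<^sup>2) \<partial>M)
        = (\<integral>\<^sup>+ \<omega>. liminf (\<lambda>k. ennreal ((norm (X n \<omega> - X (n + k) \<omega>))\<^sup>2)) \<partial>M)"
    proof (rule nn_integral_cong_AE, use lim in eventually_elim)
      fix \<omega> assume "(\<lambda>k. X k \<omega>) \<longlonglongrightarrow> Y \<omega>"
      then have "(\<lambda>k. X (k + n) \<omega>) \<longlonglongrightarrow> Y \<omega>" by (rule LIMSEQ_ignore_initial_segment)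
      then have "(\<lambda>k. ennreal ((norm (X n \<omega> - X (n + k) \<omega>))\<^sup>2)) \<longlonglongrightarrow> ennreal ((norm (X n \<omega> - Y \<omega>))\<^sup>2)"
        by (intro tendsto_ennrealI tendsto_intros) (simp add: add.commute)
      then show "ennreal ((norm (X n \<omega> - Y \<omega>))\<^sup>2) = liminf (\<lambda>k. ennreal ((norm (X n \<omega> - X (n + k) \<omega>))\<^sup>2))"
        by (rule lim_imp_Liminf[OF sequentially_bot, symmetric])
    qed
    also have "\<dots> \<le> liminf (\<lambda>k. \<integral>\<^sup>+ \<omega>. ennreal ((norm (X n \<omega> - X (n + k) \<omega>))\<^sup>2) \<partial>M)"
      by (rule nn_integral_liminf) measurable
    also have "\<dots> \<le> ennreal ((2 * (1/2)^n)\<^sup>2)"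
    proof (rule Liminf_le[OF sequentially_bot], rule eventually_sequentiallyI)
      fix k
      have "(\<integral>\<^sup>+ \<omega>. ennreal ((norm (X n \<omega> - X (n + k) \<omega>))\<^sup>2) \<partial>M) = ennreal ((L2_dist M (X (n+k)) (X n))\<^sup>2)"
        using L2_diff[OF X[of n] X[of "n+k"]]
        by (subst nn_integral_eq_integral) (auto simp: L2_dist_def L2_def norm_minus_commute)
      also have "\<dots> \<le> ennreal ((2 * (1/2)^n)\<^sup>2)"
        using dist_le[of n k] by (intro ennreal_leI power_mono) (auto intro: order_trans)
      finally show "(\<integral>\<^sup>+ \<omega>. ennreal ((norm (X n \<omega> - X (n + k) \<omega>))\<^sup>2) \<partial>M) \<le> ennreal ((2 * (1/2)^n)\<^sup>2)" .
    qed
    finally show ?thesis .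
  qed
  \<comment> \<open>Square integrability of \<open>Y\<close> itself is obtained from that of
    \<open>X 0 - Y\<close>.\<close>
  have diff: "(\<lambda>\<omega>. X n \<omega> - Y \<omega>) \<in> L2 M" for n
  proof -
    have "integrable M (\<lambda>\<omega>. (norm (X n \<omega> - Y \<omega>))\<^sup>2)"
      using sq[of n] by (intro integrableI_bounded) (auto simp: le_less_trans)
    then show ?thesis by (simp add: L2_def)
  qed
  show thesis
  proof
    show "Y \<in> L2 M" using L2_diff[OF X[of 0] diff[of 0]] by simp
    fix n
    have "ennreal (\<integral>\<omega>. (norm (X n \<omega> - Y \<omega>))\<^sup>2 \<partial>M) \<le> ennreal ((2 * (1/2)^n)\<^sup>2)"
      using sq[of n] diff[of n] by (subst (asm) nn_integral_eq_integral) (auto simp: L2_def)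
    then have "(\<integral>\<omega>. (norm (X n \<omega> - Y \<omega>))\<^sup>2 \<partial>M) \<le> (2 * (1/2)^n)\<^sup>2"
      by (simp add: ennreal_le_iff)
    then show "L2_dist M (X n) Y \<le> 2 * (1/2)^n"
      unfolding L2_dist_def by (intro real_le_lsqrt) auto
  qed
qed

section \<open>Nonatomic probability spaces\<close>

text \<open>Repeated halving: of a subset of intermediate probability and its relative complement,
  one has at most half of the probability, and both are non-null.\<close>

lemma (in prob_space) nonatomic_small_event:
  assumes na: "nonatomic M" and A: "A \<in> events" "0 < prob A" and "0 < e"
  obtains B where "B \<in> events" "B \<subseteq> A" "0 < prob B" "prob B < e"
proof -
  have ex: "\<exists>B\<in>events. B \<subseteq> A \<and> 0 < prob B \<and> prob B \<le> prob A / 2^n" for n :: nat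
  proof (induction n)
    case 0
    then show ?case using A by auto
  next
    case (Suc n)
    then obtain B where B: "B \<in> events" "B \<subseteq> A" "0 < prob B" "prob B \<le> prob A / 2^n" by blast
    then obtain C where C: "C \<in> events" "C \<subseteq> B" "0 < prob C" "prob C < prob B"
      using na unfolding nonatomic_def by blast
    have BC: "prob (B - C) = prob B - prob C"
      using B C by (intro finite_measure_Diff) auto
    show ?case
    proof (cases "prob C \<le> prob B / 2")
      case True
      then show ?thesis using B C by (intro bexI[of _ C]) auto
    next
      case False
      then show ?thesis using B C BC by (intro bexI[of _ "B - C"]) auto
    qed
  qed
  obtain n :: nat where "prob A / e < 2^n"
    using real_arch_pow[of 2 "prob A / e"] by auto
  then have "prob A / 2^n < e" using \<open>0 < e\<close> by (simp add: field_simps)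
  with ex[of n] show thesis using that by force
qed

text \<open>Sierpinski's theorem, by a greedy exhaustion.\<close>

lemma (in prob_space) nonatomic_intermediate_event:
  assumes na: "nonatomic M" and A: "A \<in> events" and t: "0 \<le> t" "t \<le> prob A"
  obtains B where "B \<in> events" "B \<subseteq> A" "prob B = t"
proof -
  \<comment> \<open>The events that can still be added to \<open>B\<close> without exceeding
    \<open>t\<close>.\<close>
  define F where "F B = {C \<in> events. C \<subseteq> A - B \<and> prob C \<le> t - prob B}" for B
  have step: "\<exists>B'. (B' \<in> events \<and> B' \<subseteq> A \<and> prob B' \<le> t) \<and>
      (B \<subseteq> B' \<and> (\<forall>C\<in>F B. prob C \<le> 2 * (prob B' - prob B)))"
    if B: "B \<in> events \<and> B \<subseteq> A \<and> prob B \<le> t" for B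
  proof -
    have "{} \<in> F B" using B by (auto simp: F_def)
    have bdd: "bdd_above (prob ` F B)" by (intro bdd_aboveI[of _ 1]) auto
    define s where "s = Sup (prob ` F B)"
    have le_s: "prob C \<le> s" if "C \<in> F B" for C
      unfolding s_def using that bdd by (intro cSup_upper) auto
    \<comment> \<open>The supremum need not be attained; half of it is enough for a greedy
      choice.\<close>
    have "\<exists>C\<in>F B. s \<le> 2 * prob C"
    proof (cases "s \<le> 0")
      case True
      then show ?thesis using \<open>{} \<in> F B\<close> by (intro bexI[of _ "{}"]) auto
    next
      case False
      then have "s / 2 < Sup (prob ` F B)" by (simp add: s_def)
      then obtain C where "C \<in> F B" "s / 2 < prob C"
        using less_cSup_iff[OF _ bdd] \<open>{} \<in> F B\<close> by blast
      then show ?thesis by (intro bexI[of _ C]) auto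
    qed
    then obtain C where C: "C \<in> F B" "s \<le> 2 * prob C" by blast
    have "prob (B \<union> C) = prob B + prob C"
      using B C by (intro finite_measure_Union) (auto simp: F_def)
    then show ?thesis
      using B C le_s by (intro exI[of _ "B \<union> C"]) (auto simp: F_def intro: order_trans)
  qed
  let ?P = "\<lambda>B. B \<in> events \<and> B \<subseteq> A \<and> prob B \<le> t"
  let ?Q = "\<lambda>B B'. B \<subseteq> B' \<and> (\<forall>C\<in>F B. prob C \<le> 2 * (prob B' - prob B))"
  have "\<exists>B. \<forall>n::nat. ?P (B n) \<and> ?Q (B n) (B (Suc n))"
  proof (rule dependent_nat_choice)
    show "\<exists>B. ?P B" using t(1) by (intro exI[of _ "{}"]) auto
  qed (rule step)
  then obtain B where B: "\<And>n::nat. ?P (B n)" and BS: "\<And>n. ?Q (B n) (B (Suc n))" by blast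
  define U where "U = (\<Union>n. B n)"
  have U: "U \<in> events" "U \<subseteq> A" using B by (auto simp: U_def)
  have "incseq B" using BS by (intro incseq_SucI) auto
  then have lim: "(\<lambda>n. prob (B n)) \<longlonglongrightarrow> prob U"
    unfolding U_def using B by (intro finite_Lim_measure_incseq) auto
  have "prob U \<le> t" using B by (intro LIMSEQ_le_const2[OF lim]) auto
  moreover have "\<not> prob U < t"
  proof
    assume less: "prob U < t"
    have "prob (A - U) = prob A - prob U" using U A by (intro finite_measure_Diff) auto
    then have "0 < prob (A - U)" using less t by simp
    then obtain C where C: "C \<in> events" "C \<subseteq> A - U" "0 < prob C" "prob C < t - prob U"
      using nonatomic_small_event[OF na, of "A - U" "t - prob U"] U A less by auto
    \<comment> \<open>An event that fits at every stage forces each increment to be at least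
      \<open>prob C / 2\<close>, although the increments tend to 0.\<close>
    have "C \<in> F (B n)" for n
    proof -
      have "prob (B n) \<le> prob U" using U B by (intro finite_measure_mono) (auto simp: U_def)
      then show ?thesis using C by (auto simp: F_def U_def)
    qed
    then have "prob C \<le> 2 * (prob (B (Suc n)) - prob (B n))" for n using BS by blast
    moreover have "(\<lambda>n. 2 * (prob (B (Suc n)) - prob (B n))) \<longlonglongrightarrow> 2 * (prob U - prob U)"
      by (intro tendsto_intros lim LIMSEQ_Suc)
    ultimately have "prob C \<le> 2 * (prob U - prob U)" by (intro LIMSEQ_le_const) auto
    then show False using C by simp
  qed
  ultimately show thesis using that U by force
qed

text \<open>Appends one bit to a code. On each fibre of \<open>J\<close>, intermediate events give
  the new bit the probability that \<open>H\<close> has on the matching fibre of \<open>J'\<close>;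
  the old code is recovered by halving.\<close>

lemma (in prob_space) nonatomic_split:
  fixes J :: "'a \<Rightarrow> nat" and J' :: "'c \<Rightarrow> nat"
  assumes na: "nonatomic M" and N: "prob_space N"
    and J[measurable]: "J \<in> measurable M (count_space UNIV)"
    and J'[measurable]: "J' \<in> measurable N (count_space UNIV)"
    and eq: "distr M (count_space UNIV) J = distr N (count_space UNIV) J'"
    and H[measurable]: "H \<in> sets N"
  obtains E where "E \<in> events"
    "distr M (count_space UNIV) (\<lambda>\<omega>. 2 * J \<omega> + of_bool (\<omega> \<in> E))
      = distr N (count_space UNIV) (\<lambda>\<omega>. 2 * J' \<omega> + of_bool (\<omega> \<in> H))"
proof -
  interpret N: prob_space N by fact
  have fib: "prob (J -` {j} \<inter> space M) = measure N (J' -` {j} \<inter> space N)" for j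
  proof -
    have "prob (J -` {j} \<inter> space M) = measure (distr M (count_space UNIV) J) {j}"
      by (simp add: measure_distr)
    then show ?thesis unfolding eq by (simp add: measure_distr)
  qed
  have "\<exists>E\<in>events. E \<subseteq> J -` {j} \<inter> space M \<and> prob E = measure N (H \<inter> (J' -` {j} \<inter> space N))" for j
  proof -
    have "measure N (H \<inter> (J' -` {j} \<inter> space N)) \<le> prob (J -` {j} \<inter> space M)"
      unfolding fib by (intro N.finite_measure_mono) auto
    then show ?thesis
      using nonatomic_intermediate_event[OF na, of "J -` {j} \<inter> space M" "measure N (H \<inter> (J' -` {j} \<inter> space N))"]
      by (metis J measurable_sets measure_nonneg sets_count_space UNIV_I Pow_UNIV)
  qed
  then obtain E where E[measurable]: "\<And>j. E j \<in> events" and Esub: "\<And>j. E j \<subseteq> J -` {j} \<inter> space M"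
    and Ep: "\<And>j. prob (E j) = measure N (H \<inter> (J' -` {j} \<inter> space N))" by metis
  define U where "U = (\<Union>j. E j)"
  have U[measurable]: "U \<in> events" by (auto simp: U_def)
  have Uj: "U \<inter> (J -` {j} \<inter> space M) = E j" for j using Esub by (fastforce simp: U_def)
  show thesis
  proof (rule that[OF U])
    let ?K = "\<lambda>\<omega>. 2 * J \<omega> + of_bool (\<omega> \<in> U)" and ?K' = "\<lambda>\<omega>. 2 * J' \<omega> + of_bool (\<omega> \<in> H)"
    have K[measurable]: "?K \<in> measurable M (count_space UNIV)"
      "?K' \<in> measurable N (count_space UNIV)" by measurable
    show "distr M (count_space UNIV) ?K = distr N (count_space UNIV) ?K'"
    proof (rule measure_eqI_countable[of _ UNIV])
      fix n :: nat
      define j where "j = n div 2"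
      have "prob (?K -` {n} \<inter> space M) = measure N (?K' -` {n} \<inter> space N)"
      proof (cases "odd n")
        case True
        then have n: "n = Suc (2 * j)" by (simp add: j_def)
        have "?K -` {n} \<inter> space M = U \<inter> (J -` {j} \<inter> space M)"
          by (auto simp: n of_bool_def split: if_splits; presburger)
        moreover have "?K' -` {n} \<inter> space N = H \<inter> (J' -` {j} \<inter> space N)"
          by (auto simp: n of_bool_def split: if_splits; presburger)
        ultimately show ?thesis by (simp add: Uj Ep)
      next
        case False
        then have n: "n = 2 * j" by (simp add: j_def)
        have "?K -` {n} \<inter> space M = (J -` {j} \<inter> space M) - E j"
          unfolding Uj[symmetric] by (auto simp: n of_bool_def split: if_splits; presburger)
        moreover have "?K' -` {n} \<inter> space N = (J' -` {j} \<inter> space N) - H \<inter> (J' -` {j} \<inter> space N)"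
          by (auto simp: n of_bool_def split: if_splits; presburger)
        moreover have "prob ((J -` {j} \<inter> space M) - E j) = prob (J -` {j} \<inter> space M) - prob (E j)"
          using Esub by (intro finite_measure_Diff) auto
        moreover have "measure N ((J' -` {j} \<inter> space N) - H \<inter> (J' -` {j} \<inter> space N))
            = measure N (J' -` {j} \<inter> space N) - measure N (H \<inter> (J' -` {j} \<inter> space N))"
          by (intro N.finite_measure_Diff) auto
        ultimately show ?thesis by (simp add: fib Ep)
      qed
      then show "emeasure (distr M (count_space UNIV) ?K) {n} = emeasure (distr N (count_space UNIV) ?K') {n}"
        by (simp add: emeasure_distr emeasure_eq_measure N.emeasure_eq_measure)
    qed auto
  qed
qed

text \<open>Used to decode a coordinate from its bits. The value \<open>-\<infinity>\<close> at
  unmarked indices turns the decoding into one supremum over all of \<open>nat\<close>, so that it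
  is measurable in the bits.\<close>

lemma SUP_rationals_below:
  fixes x :: real and q :: "nat \<Rightarrow> real"
  assumes "\<And>n. P n \<Longrightarrow> q n < x" and "\<And>r. r \<in> \<rat> \<Longrightarrow> r < x \<Longrightarrow> \<exists>n. P n \<and> q n = r"
  shows "(SUP n. if P n then ereal (q n) else -\<infinity>) = ereal x"
proof (rule SUP_eqI)
  show "(if P n then ereal (q n) else -\<infinity>) \<le> ereal x" for n
    using assms(1)[of n] by auto
  fix y assume y: "\<And>n. n \<in> UNIV \<Longrightarrow> (if P n then ereal (q n) else -\<infinity>) \<le> y"
  have *: "ereal r \<le> y" if r: "r \<in> \<rat>" "r < x" for r
  proof -
    obtain n where "P n" "q n = r" using assms(2)[OF r] by blast
    then show ?thesis using y[of n] by simp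
  qed
  show "ereal x \<le> y"
  proof (cases y)
    case (real z)
    show ?thesis
    proof (rule ccontr)
      assume "\<not> ereal x \<le> y"
      then have "z < x" using real by simp
      then obtain r where "r \<in> \<rat>" "z < r" "r < x" using Rats_dense_in_real by blast
      then show False using *[of r] real by simp
    qed
  next
    case MInf
    obtain r where "r \<in> \<rat>" "r < x" using Rats_dense_in_real[of "x - 1" x] by auto
    then show ?thesis using *[of r] MInf by simp
  qed simp
qed

text \<open>The random vector is encoded by a sequence of bits, one for each half-space
  \<open>{x. q < x \<bullet> b}\<close> with rational \<open>q\<close> and basis vector \<open>b\<close>. Splitting
  events one bit at a time yields a sequence of codes on \<open>M\<close> with the law of the
  original sequence, from which the vector is decoded.\<close>

lemma (in prob_space) nonatomic_transfer:
  fixes X' :: "'c \<Rightarrow> 'b::euclidean_space" and D :: "'a \<Rightarrow> nat" and D' :: "'c \<Rightarrow> nat"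
  assumes na: "nonatomic M" and N: "prob_space N"
    and D[measurable]: "D \<in> measurable M (count_space UNIV)"
    and D'[measurable]: "D' \<in> measurable N (count_space UNIV)"
    and eq: "distr M (count_space UNIV) D = distr N (count_space UNIV) D'"
    and X'[measurable]: "X' \<in> borel_measurable N"
  obtains X where "X \<in> borel_measurable M"
    "distr M (count_space UNIV \<Otimes>\<^sub>M borel) (\<lambda>\<omega>. (D \<omega>, X \<omega>))
      = distr N (count_space UNIV \<Otimes>\<^sub>M borel) (\<lambda>\<omega>. (D' \<omega>, X' \<omega>))"
proof -
  interpret N: prob_space N by fact
  define h :: "nat \<Rightarrow> 'b \<times> real" where "h = from_nat_into (Basis \<times> \<rat>)"
  have range_h: "range h = Basis \<times> \<rat>"
    unfolding h_def by (intro range_from_nat_into) (auto intro!: countable_SIGMA countable_rat intro: countable_finite)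
  define H where "H n = {\<omega> \<in> space N. snd (h n) < X' \<omega> \<bullet> fst (h n)}" for n
  have H[measurable]: "H n \<in> sets N" for n unfolding H_def by measurable
  define J' where "J' = rec_nat D' (\<lambda>n J \<omega>. 2 * J \<omega> + of_bool (\<omega> \<in> H n))"
  have J'0: "J' 0 = D'" and J'Suc: "J' (Suc n) = (\<lambda>\<omega>. 2 * J' n \<omega> + of_bool (\<omega> \<in> H n))" for n
    by (simp_all add: J'_def)
  have J'[measurable]: "J' n \<in> measurable N (count_space UNIV)" for n
    by (induction n) (simp_all add: J'0 J'Suc D')
  \<comment> \<open>The last conjunct makes the chosen sequence start at the given \<open>D\<close>,
    as the joint law with \<open>D\<close> is wanted.\<close>
  let ?P = "\<lambda>n J. J \<in> measurable M (count_space UNIV) \<and>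
    distr M (count_space UNIV) J = distr N (count_space UNIV) (J' n) \<and> (n = 0 \<longrightarrow> J = D)"
  let ?Q = "\<lambda>J K. \<exists>E\<in>events. K = (\<lambda>\<omega>. 2 * J \<omega> + of_bool (\<omega> \<in> E))"
  have "\<exists>J. \<forall>n. ?P n (J n) \<and> ?Q (J n) (J (Suc n))"
  proof (rule dependent_nat_choice)
    show "\<exists>J. ?P 0 J" using D eq by (auto simp: J'0)
    fix J n assume P: "?P n J"
    then have JJ[measurable]: "J \<in> measurable M (count_space UNIV)" by simp
    obtain E where E[measurable]: "E \<in> events"
      and "distr M (count_space UNIV) (\<lambda>\<omega>. 2 * J \<omega> + of_bool (\<omega> \<in> E))
        = distr N (count_space UNIV) (\<lambda>\<omega>. 2 * J' n \<omega> + of_bool (\<omega> \<in> H n))"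
      using nonatomic_split[OF na N JJ J'[of n] _ H[of n]] P by auto
    then have "?P (Suc n) (\<lambda>\<omega>. 2 * J \<omega> + of_bool (\<omega> \<in> E))" by (simp add: J'Suc)
    then show "\<exists>K. ?P (Suc n) K \<and> ?Q J K" using E by blast
  qed
  then obtain J where J[measurable]: "\<And>n. J n \<in> measurable M (count_space UNIV)"
    and Jeq: "\<And>n. distr M (count_space UNIV) (J n) = distr N (count_space UNIV) (J' n)"
    and J0: "J 0 = D" and JSuc: "\<And>n. \<exists>E\<in>events. J (Suc n) = (\<lambda>\<omega>. 2 * J n \<omega> + of_bool (\<omega> \<in> E))"
    by auto
  \<comment> \<open>Earlier codes are functions of later ones, so the law of a single
    \<open>J n\<close> determines the joint law of all codes up to \<open>n\<close>. This reduces
    \<open>seq\<close> to the equalities \<open>Jeq\<close>.\<close>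
  have Jdiv: "J (i + k) \<omega> div 2 ^ k = J i \<omega>" for i k \<omega>
  proof (induction k)
    case (Suc k)
    obtain E where "J (Suc (i + k)) = (\<lambda>\<omega>. 2 * J (i + k) \<omega> + of_bool (\<omega> \<in> E))" using JSuc by blast
    then have "J (i + Suc k) \<omega> div 2 = J (i + k) \<omega>" by (simp add: of_bool_def)
    then show ?case using Suc by (simp add: div_mult2_eq)
  qed simp
  have J'div: "J' (i + k) \<omega> div 2 ^ k = J' i \<omega>" for i k \<omega>
  proof (induction k)
    case (Suc k)
    have "J' (i + Suc k) \<omega> div 2 = J' (i + k) \<omega>" by (simp add: J'Suc of_bool_def)
    then show ?case using Suc by (simp add: div_mult2_eq)
  qed simp
  let ?S = "PiM UNIV (\<lambda>_::nat. count_space (UNIV::nat set))"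
  have sJ[measurable]: "(\<lambda>\<omega> i. J i \<omega>) \<in> measurable M ?S"
    by (rule measurable_PiM_single') auto
  have sJ'[measurable]: "(\<lambda>\<omega> i. J' i \<omega>) \<in> measurable N ?S"
    by (rule measurable_PiM_single') auto
  have seq: "distr M ?S (\<lambda>\<omega> i. J i \<omega>) = distr N ?S (\<lambda>\<omega> i. J' i \<omega>)"
  proof (rule measure_eqI_PiM_infinite)
    fix A :: "nat \<Rightarrow> nat set" and I :: "nat set"
    assume I: "finite I"
    obtain n where n: "\<And>i. i \<in> I \<Longrightarrow> i \<le> n" using I by (meson finite_nat_set_iff_bounded_le)
    define B where "B = {c. \<forall>i\<in>I. c div 2 ^ (n - i) \<in> A i}"
    let ?C = "prod_emb UNIV (\<lambda>_. count_space UNIV) I (Pi\<^sub>E I A)"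
    have C: "?C \<in> sets ?S" using I by (intro sets_PiM_I) auto
    have 1: "(\<lambda>\<omega> i. J i \<omega>) -` ?C \<inter> space M = J n -` B \<inter> space M"
    proof -
      have "J n \<omega> div 2 ^ (n - i) = J i \<omega>" if "i \<in> I" for i \<omega>
        using Jdiv[of i "n - i" \<omega>] n[OF that] by simp
      then show ?thesis by (auto simp: prod_emb_def B_def PiE_iff)
    qed
    have 2: "(\<lambda>\<omega> i. J' i \<omega>) -` ?C \<inter> space N = J' n -` B \<inter> space N"
    proof -
      have "J' n \<omega> div 2 ^ (n - i) = J' i \<omega>" if "i \<in> I" for i \<omega>
        using J'div[of i "n - i" \<omega>] n[OF that] by simp
      then show ?thesis by (auto simp: prod_emb_def B_def PiE_iff)
    qed
    have "emeasure (distr M ?S (\<lambda>\<omega> i. J i \<omega>)) ?C = emeasure (distr M (count_space UNIV) (J n)) B"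
      using C by (simp add: emeasure_distr 1)
    also have "\<dots> = emeasure (distr N ?S (\<lambda>\<omega> i. J' i \<omega>)) ?C"
      using C by (simp add: Jeq emeasure_distr 2)
    finally show "emeasure (distr M ?S (\<lambda>\<omega> i. J i \<omega>)) ?C = emeasure (distr N ?S (\<lambda>\<omega> i. J' i \<omega>)) ?C" .
  qed (auto intro!: finite_measure_distr)
  \<comment> \<open>The bit for \<open>H n\<close> is the last one of the code with index
    \<open>Suc n\<close>. On \<open>N\<close> the suprema are finite; \<open>real_of_ereal\<close>
    only supplies a value for code sequences that do not occur there.\<close>
  define \<Psi> :: "(nat \<Rightarrow> nat) \<Rightarrow> 'b" where
    "\<Psi> s = (\<Sum>b\<in>Basis. real_of_ereal
      (SUP n. if fst (h n) = b \<and> odd (s (Suc n)) then ereal (snd (h n)) else -\<infinity>) *\<^sub>R b)" for s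
  have [measurable]: "\<Psi> \<in> borel_measurable ?S"
    unfolding \<Psi>_def by measurable
  have \<Psi>: "\<Psi> (\<lambda>i. J' i \<omega>) = X' \<omega>" if \<omega>: "\<omega> \<in> space N" for \<omega>
  proof -
    have "(SUP n. if fst (h n) = b \<and> odd (J' (Suc n) \<omega>) then ereal (snd (h n)) else -\<infinity>)
        = ereal (X' \<omega> \<bullet> b)" if b: "b \<in> Basis" for b
    proof (rule SUP_rationals_below)
      show "snd (h n) < X' \<omega> \<bullet> b" if "fst (h n) = b \<and> odd (J' (Suc n) \<omega>)" for n
        using that by (auto simp: J'Suc H_def split: if_splits)
      show "\<exists>n. (fst (h n) = b \<and> odd (J' (Suc n) \<omega>)) \<and> snd (h n) = r"
        if r: "r \<in> \<rat>" "r < X' \<omega> \<bullet> b" for r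
      proof -
        have "(b, r) \<in> range h" using b r by (simp add: range_h)
        then obtain n where "h n = (b, r)" by (metis imageE)
        then show ?thesis using r \<omega> by (intro exI[of _ n]) (auto simp: J'Suc H_def)
      qed
    qed
    then show ?thesis by (simp add: \<Psi>_def euclidean_representation)
  qed
  show thesis
  proof
    show "(\<lambda>\<omega>. \<Psi> (\<lambda>i. J i \<omega>)) \<in> borel_measurable M" by measurable
    let ?g = "\<lambda>s. (s 0, \<Psi> s)" and ?T = "count_space UNIV \<Otimes>\<^sub>M borel :: (nat \<times> 'b) measure"
    have g[measurable]: "?g \<in> measurable ?S ?T" by measurable
    have "distr M ?T (\<lambda>\<omega>. (D \<omega>, \<Psi> (\<lambda>i. J i \<omega>))) = distr (distr M ?S (\<lambda>\<omega> i. J i \<omega>)) ?T ?g"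
      by (subst distr_distr) (auto simp: comp_def J0)
    also have "\<dots> = distr N ?T (\<lambda>\<omega>. (D' \<omega>, \<Psi> (\<lambda>i. J' i \<omega>)))"
      unfolding seq by (subst distr_distr) (auto simp: comp_def J'0)
    also have "\<dots> = distr N ?T (\<lambda>\<omega>. (D' \<omega>, X' \<omega>))"
      using \<Psi> by (intro distr_cong) auto
    finally show "distr M ?T (\<lambda>\<omega>. (D \<omega>, \<Psi> (\<lambda>i. J i \<omega>))) = distr N ?T (\<lambda>\<omega>. (D' \<omega>, X' \<omega>))" .
  qed
qed

text \<open>The identity on \<open>K\<close> is transferred along a constant code.\<close>

lemma (in prob_space) nonatomic_ex_has_law:
  assumes na: "nonatomic M" and K: "prob_space K" "sets K = sets borel"
  obtains U :: "'a \<Rightarrow> 'b::euclidean_space" where "has_law M U K"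
proof -
  interpret K: prob_space K by fact
  have [measurable_cong]: "sets K = sets borel" by fact
  have id: "(\<lambda>x. x) \<in> borel_measurable K" by measurable
  have eq0: "distr M (count_space UNIV) (\<lambda>_. 0::nat) = distr K (count_space UNIV) (\<lambda>_. 0)"
    by (simp add: distr_const K.distr_const)
  obtain U :: "'a \<Rightarrow> 'b" where U[measurable]: "U \<in> borel_measurable M"
    and eq: "distr M (count_space UNIV \<Otimes>\<^sub>M borel) (\<lambda>\<omega>. (0::nat, U \<omega>))
      = distr K (count_space UNIV \<Otimes>\<^sub>M borel) (\<lambda>x. (0, x))"
    by (rule nonatomic_transfer[OF na K(1) _ _ eq0 id]) auto
  have "distr M borel U = distr (distr M (count_space UNIV \<Otimes>\<^sub>M borel) (\<lambda>\<omega>. (0::nat, U \<omega>))) borel snd"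
    by (subst distr_distr) (auto simp: comp_def)
  also have "\<dots> = distr K borel (\<lambda>x. x)"
    unfolding eq by (subst distr_distr) (auto simp: comp_def)
  also have "\<dots> = K" using K(2) by (rule distr_id2[OF sym])
  finally have "has_law M U K" using U by (simp add: has_law_def)
  then show thesis by (rule that)
qed

section \<open>Equality in law and the transfer of couplings\<close>

lemma same_law_integral:
  fixes g :: "'b::euclidean_space \<Rightarrow> 'c::{banach, second_countable_topology}"
  assumes "same_law M X Y" and [measurable]: "g \<in> borel_measurable borel"
  shows "(\<integral>\<omega>. g (X \<omega>) \<partial>M) = (\<integral>\<omega>. g (Y \<omega>) \<partial>M)"
    and "integrable M (\<lambda>\<omega>. g (X \<omega>)) \<longleftrightarrow> integrable M (\<lambda>\<omega>. g (Y \<omega>))"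
  using assms integral_distr[of X M borel g] integral_distr[of Y M borel g]
    integrable_distr_eq[of X M borel g] integrable_distr_eq[of Y M borel g]
  by (auto simp: same_law_def)

lemma same_law_sym: "same_law M X Y \<Longrightarrow> same_law M Y X"
  by (auto simp: same_law_def)

lemma same_law_L2:
  assumes "same_law M X Y" "X \<in> L2 M"
  shows "Y \<in> L2 M"
  using assms same_law_integral(2)[OF assms(1), of "\<lambda>x. (norm x)\<^sup>2"]
  by (auto simp: L2_def same_law_def)

lemma same_law_compose:
  assumes "same_law M X Y" and [measurable]: "g \<in> borel_measurable borel"
  shows "same_law M (\<lambda>\<omega>. g (X \<omega>)) (\<lambda>\<omega>. g (Y \<omega>))"
proof -
  have [measurable]: "X \<in> borel_measurable M" "Y \<in> borel_measurable M"
    and eq: "distr M borel X = distr M borel Y" using assms by (auto simp: same_law_def)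
  have "distr M borel (\<lambda>\<omega>. g (X \<omega>)) = distr (distr M borel X) borel g"
    by (subst distr_distr) (auto simp: comp_def)
  also have "\<dots> = distr M borel (\<lambda>\<omega>. g (Y \<omega>))"
    unfolding eq by (subst distr_distr) (auto simp: comp_def)
  finally show ?thesis by (simp add: same_law_def)
qed

lemma has_law_same_law: "has_law M X \<nu> \<Longrightarrow> has_law M Y \<nu> \<Longrightarrow> same_law M X Y"
  by (auto simp: has_law_def same_law_def)

lemma has_law_P2_L2:
  assumes "has_law M X \<nu>" "\<nu> \<in> P2"
  shows "X \<in> L2 M"
proof -
  have "integrable (distr M borel X) (\<lambda>x. (norm x)\<^sup>2)"
    using assms by (simp add: has_law_def P2_def)
  then have "integrable M (\<lambda>\<omega>. (norm (X \<omega>))\<^sup>2)"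
    using assms by (subst (asm) integrable_distr_eq) (auto simp: has_law_def)
  then show ?thesis using assms by (simp add: L2_def has_law_def)
qed

lemma (in prob_space) distr_L2_P2:
  assumes "X \<in> L2 M"
  shows "distr M borel X \<in> P2"
  using assms by (auto simp: P2_def L2_def integrable_distr_eq intro: prob_space_distr)

text \<open>Round \<open>A\<close> and \<open>A1\<close> to a countable dense set. The codes of the
  rounded vectors have the same law, so \<open>B\<close> can be transferred jointly with the code;
  the correlation with the rounded vector is then preserved exactly, and rounding costs at most
  \<open>\<delta>\<close> times the mean norm of \<open>B\<close> on each side.\<close>

lemma (in prob_space) correlation_transfer:
  fixes A A1 B :: "'a \<Rightarrow> 'b::euclidean_space"
  assumes na: "nonatomic M" and A: "A \<in> L2 M" and B: "B \<in> L2 M"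
    and law: "same_law M A1 A" and e: "0 < e"
  obtains B1 where "same_law M B1 B" "\<bar>correlation M A1 B1 - correlation M A B\<bar> \<le> e"
proof -
  obtain S :: "'b set" where S: "countable S" "\<And>U. open U \<Longrightarrow> U \<noteq> {} \<Longrightarrow> \<exists>d\<in>S. d \<in> U"
    using countable_dense_setE by blast
  have "S \<noteq> {}" using S(2)[of UNIV] by auto
  define d where "d = from_nat_into S"
  have "S \<subseteq> range d" using S(1) \<open>S \<noteq> {}\<close> by (simp add: d_def range_from_nat_into)
  \<comment> \<open>Two rounding errors together stay below \<open>e\<close>; the summand 1 guards
    against \<open>B\<close> being zero almost surely.\<close>
  define \<delta> where "\<delta> = e / (2 * (expectation (\<lambda>\<omega>. norm (B \<omega>)) + 1))"
  have Bnn: "0 \<le> expectation (\<lambda>\<omega>. norm (B \<omega>))" by simp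
  have \<delta>: "0 < \<delta>" using e Bnn by (simp add: \<delta>_def add_nonneg_pos)
  have \<delta>e: "2 * (\<delta> * expectation (\<lambda>\<omega>. norm (B \<omega>))) \<le> e"
  proof -
    have "\<delta> * (2 * (expectation (\<lambda>\<omega>. norm (B \<omega>)) + 1)) = e"
      using add_nonneg_pos[OF Bnn zero_less_one] unfolding \<delta>_def by (simp add: field_simps)
    then show ?thesis using \<delta> by (simp add: algebra_simps)
  qed
  define c where "c v = (LEAST n. dist v (d n) < \<delta>)" for v
  have c[measurable]: "c \<in> measurable borel (count_space UNIV)"
    unfolding c_def by measurable
  have dc: "norm (v - d (c v)) < \<delta>" for v
  proof -
    have "\<exists>n. dist v (d n) < \<delta>"
      using S(2)[of "ball v \<delta>"] \<delta> \<open>S \<subseteq> range d\<close> by auto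
    then show ?thesis unfolding c_def dist_norm[symmetric] by (rule LeastI_ex)
  qed
  have A1: "A1 \<in> L2 M" using law A same_law_L2 same_law_sym by blast
  have [measurable]: "A \<in> borel_measurable M" "A1 \<in> borel_measurable M" "B \<in> borel_measurable M"
    using A A1 B by (auto simp: L2_def)
  have "distr M (count_space UNIV) (\<lambda>\<omega>. c (A1 \<omega>)) = distr (distr M borel A1) (count_space UNIV) c"
    by (subst distr_distr) (auto simp: comp_def)
  also have "\<dots> = distr M (count_space UNIV) (\<lambda>\<omega>. c (A \<omega>))"
    using law by (simp add: same_law_def distr_distr comp_def)
  finally have eqc: "distr M (count_space UNIV) (\<lambda>\<omega>. c (A1 \<omega>)) = distr M (count_space UNIV) (\<lambda>\<omega>. c (A \<omega>))" .
  obtain B1 where B1[measurable]: "B1 \<in> borel_measurable M"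
    and eq: "distr M (count_space UNIV \<Otimes>\<^sub>M borel) (\<lambda>\<omega>. (c (A1 \<omega>), B1 \<omega>))
      = distr M (count_space UNIV \<Otimes>\<^sub>M borel) (\<lambda>\<omega>. (c (A \<omega>), B \<omega>))"
    by (rule nonatomic_transfer[OF na prob_space_axioms _ _ eqc, of B]) auto
  have "distr M borel B1 = distr (distr M (count_space UNIV \<Otimes>\<^sub>M borel) (\<lambda>\<omega>. (c (A1 \<omega>), B1 \<omega>))) borel snd"
    by (subst distr_distr) (auto simp: comp_def)
  also have "\<dots> = distr M borel B"
    unfolding eq by (subst distr_distr) (auto simp: comp_def)
  finally have lawB: "same_law M B1 B" by (simp add: same_law_def)
  have B1L: "B1 \<in> L2 M" using lawB B same_law_L2 same_law_sym by blast
  have approx: "\<bar>correlation M V W - (\<integral>\<omega>. d (c (V \<omega>)) \<bullet> W \<omega> \<partial>M)\<bar> \<le> \<delta> * expectation (\<lambda>\<omega>. norm (W \<omega>))"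
    if V: "V \<in> L2 M" and W: "W \<in> L2 M" for V W
  proof -
    have [measurable]: "V \<in> borel_measurable M" "W \<in> borel_measurable M" using V W by (auto simp: L2_def)
    have le: "\<bar>(V \<omega> - d (c (V \<omega>))) \<bullet> W \<omega>\<bar> \<le> \<delta> * norm (W \<omega>)" for \<omega>
      using Cauchy_Schwarz_ineq2[of "V \<omega> - d (c (V \<omega>))" "W \<omega>"] dc[of "V \<omega>"]
      by (smt (verit) mult_right_mono norm_ge_zero)
    have int: "integrable M (\<lambda>\<omega>. (V \<omega> - d (c (V \<omega>))) \<bullet> W \<omega>)"
    proof (rule Bochner_Integration.integrable_bound)
      show "integrable M (\<lambda>\<omega>. \<delta> * norm (W \<omega>))"
        using expectation_norm_le_L2_norm(1)[OF W] by simp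
      show "AE \<omega> in M. norm ((V \<omega> - d (c (V \<omega>))) \<bullet> W \<omega>) \<le> norm (\<delta> * norm (W \<omega>))"
        using le \<delta> by (intro AE_I2) simp
    qed measurable
    have "integrable M (\<lambda>\<omega>. V \<omega> \<bullet> W \<omega> - (V \<omega> - d (c (V \<omega>))) \<bullet> W \<omega>)"
      using L2_integrable_inner[OF V W] int by (rule Bochner_Integration.integrable_diff)
    then have "integrable M (\<lambda>\<omega>. d (c (V \<omega>)) \<bullet> W \<omega>)" by (simp add: inner_diff_left)
    then have "correlation M V W - (\<integral>\<omega>. d (c (V \<omega>)) \<bullet> W \<omega> \<partial>M)
        = expectation (\<lambda>\<omega>. (V \<omega> - d (c (V \<omega>))) \<bullet> W \<omega>)"
      using L2_integrable_inner[OF V W] by (simp add: correlation_def inner_diff_left)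
    also have "\<bar>\<dots>\<bar> \<le> expectation (\<lambda>\<omega>. \<delta> * norm (W \<omega>))"
      using le int expectation_norm_le_L2_norm(1)[OF W]
      by (intro order_trans[OF integral_abs_bound] integral_mono) auto
    finally show ?thesis by simp
  qed
  have "(\<integral>\<omega>. d (c (A1 \<omega>)) \<bullet> B1 \<omega> \<partial>M)
      = (\<integral>p. d (fst p) \<bullet> snd p \<partial>distr M (count_space UNIV \<Otimes>\<^sub>M borel) (\<lambda>\<omega>. (c (A1 \<omega>), B1 \<omega>)))"
    by (subst integral_distr) auto
  also have "\<dots> = (\<integral>\<omega>. d (c (A \<omega>)) \<bullet> B \<omega> \<partial>M)"
    unfolding eq by (subst integral_distr) auto
  finally have "(\<integral>\<omega>. d (c (A1 \<omega>)) \<bullet> B1 \<omega> \<partial>M) = (\<integral>\<omega>. d (c (A \<omega>)) \<bullet> B \<omega> \<partial>M)" .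
  moreover have "expectation (\<lambda>\<omega>. norm (B1 \<omega>)) = expectation (\<lambda>\<omega>. norm (B \<omega>))"
    by (rule same_law_integral[OF lawB]) measurable
  ultimately have "\<bar>correlation M A1 B1 - correlation M A B\<bar> \<le> e"
    using approx[OF A1 B1L] approx[OF A B] \<delta>e by (smt (verit))
  then show thesis using that lawB by blast
qed

section \<open>Continuity of convex functionals and semidiscrete optimal transport\<close>

text \<open>A Baire category argument: some ball carries an upper bound of the even convex function
  \<open>\<lambda>Y. max (\<rho> (X + Y)) (\<rho> (X - Y))\<close>, hence so does the ball of the same radius
  around \<open>0\<close>.\<close>

lemma (in prob_space) convex_lsc_locally_bounded:
  fixes \<rho> :: "('a \<Rightarrow> 'b::euclidean_space) \<Rightarrow> real"
  assumes lsc: "lsc_functional M \<rho>" and conv: "convex_functional M \<rho>" and X: "X \<in> L2 M"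
  obtains r B where "0 < r" and "\<And>Y. Y \<in> L2 M \<Longrightarrow> L2_norm M Y < r \<Longrightarrow> \<rho> (\<lambda>\<omega>. X \<omega> + Y \<omega>) \<le> B"
proof -
  \<comment> \<open>Symmetrising lets a bound on a ball around some \<open>Y\<close> be reflected to
    the ball around \<open>- Y\<close>.\<close>
  define p where "p Y = max (\<rho> (\<lambda>\<omega>. X \<omega> + Y \<omega>)) (\<rho> (\<lambda>\<omega>. X \<omega> - Y \<omega>))" for Y
  have p_even: "p (\<lambda>\<omega>. - Y \<omega>) = p Y" for Y by (simp add: p_def max.commute)
  have p_mid: "p (\<lambda>\<omega>. (1/2) *\<^sub>R (Y \<omega> + Z \<omega>)) \<le> max (p Y) (p Z)"
    if Y: "Y \<in> L2 M" and Z: "Z \<in> L2 M" for Y Z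
  proof -
    have 1: "\<rho> (\<lambda>\<omega>. X \<omega> + (1/2) *\<^sub>R (Y \<omega> + Z \<omega>)) \<le> (1/2) * \<rho> (\<lambda>\<omega>. X \<omega> + Y \<omega>) + (1/2) * \<rho> (\<lambda>\<omega>. X \<omega> + Z \<omega>)"
    proof -
      have "(\<lambda>\<omega>. (1/2) *\<^sub>R (X \<omega> + Y \<omega>) + (1 - 1/2) *\<^sub>R (X \<omega> + Z \<omega>)) = (\<lambda>\<omega>. X \<omega> + (1/2) *\<^sub>R (Y \<omega> + Z \<omega>))"
        by (simp add: scaleR_right_distrib fun_eq_iff flip: scaleR_left_distrib)
      then show ?thesis
        using conv[unfolded convex_functional_def, rule_format, OF L2_add[OF X Y] L2_add[OF X Z], of "1/2"] by simp
    qed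
    have 2: "\<rho> (\<lambda>\<omega>. X \<omega> - (1/2) *\<^sub>R (Y \<omega> + Z \<omega>)) \<le> (1/2) * \<rho> (\<lambda>\<omega>. X \<omega> - Y \<omega>) + (1/2) * \<rho> (\<lambda>\<omega>. X \<omega> - Z \<omega>)"
    proof -
      have "(\<lambda>\<omega>. (1/2) *\<^sub>R (X \<omega> - Y \<omega>) + (1 - 1/2) *\<^sub>R (X \<omega> - Z \<omega>)) = (\<lambda>\<omega>. X \<omega> - (1/2) *\<^sub>R (Y \<omega> + Z \<omega>))"
        by (simp add: scaleR_right_distrib scaleR_right_diff_distrib fun_eq_iff flip: scaleR_left_distrib)
      then show ?thesis
        using conv[unfolded convex_functional_def, rule_format, OF L2_diff[OF X Y] L2_diff[OF X Z], of "1/2"] by simp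
    qed
    show ?thesis using 1 2 unfolding p_def by linarith
  qed
  have p_lsc: "\<exists>s>0. \<forall>Z\<in>L2 M. L2_dist M Y Z < s \<longrightarrow> c < p Z" if Y: "Y \<in> L2 M" and c: "c < p Y" for Y c
  proof -
    have "\<exists>s>0. \<forall>Z\<in>L2 M. L2_dist M Y Z < s \<longrightarrow> c < \<rho> (\<lambda>\<omega>. X \<omega> + Z \<omega>)" if "c < \<rho> (\<lambda>\<omega>. X \<omega> + Y \<omega>)"
      using lsc[unfolded lsc_functional_def, rule_format, OF L2_add[OF X Y], of "\<rho> (\<lambda>\<omega>. X \<omega> + Y \<omega>) - c"] that
        L2_add[OF X] by (auto simp: L2_dist_add_cancel)
    moreover have "\<exists>s>0. \<forall>Z\<in>L2 M. L2_dist M Y Z < s \<longrightarrow> c < \<rho> (\<lambda>\<omega>. X \<omega> - Z \<omega>)" if "c < \<rho> (\<lambda>\<omega>. X \<omega> - Y \<omega>)"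
    proof -
      have "L2_dist M (\<lambda>\<omega>. X \<omega> - Y \<omega>) (\<lambda>\<omega>. X \<omega> - Z \<omega>) = L2_dist M Y Z" for Z
        by (simp add: L2_dist_def norm_minus_commute)
      then show ?thesis
        using lsc[unfolded lsc_functional_def, rule_format, OF L2_diff[OF X Y], of "\<rho> (\<lambda>\<omega>. X \<omega> - Y \<omega>) - c"] that
          L2_diff[OF X] by auto
    qed
    ultimately show ?thesis using c unfolding p_def less_max_iff_disj by blast
  qed
  have "\<exists>n. \<exists>Y\<in>L2 M. \<exists>r>0. \<forall>Z\<in>L2 M. L2_dist M Y Z < r \<longrightarrow> p Z \<le> real n"
  proof (rule ccontr)
    assume neg: "\<not> ?thesis"
    \<comment> \<open>Pairs of centre and radius: nested balls with \<open>p\<close> above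
      \<open>n\<close> on the ball with index \<open>Suc n\<close>.\<close>
    let ?P = "\<lambda>n (Y :: 'a \<Rightarrow> 'b, s). Y \<in> L2 M \<and> 0 < s \<and> s \<le> (1/2::real)^n"
    let ?Q = "\<lambda>n (Y, s) (Y', s'). L2_dist M Y Y' + s' \<le> s / 2 \<and>
      (\<forall>Z\<in>L2 M. L2_dist M Y' Z < s' \<longrightarrow> real n < p Z)"
    have "\<exists>f. \<forall>n. ?P n (f n) \<and> ?Q n (f n) (f (Suc n))"
    proof (rule dependent_nat_choice)
      show "\<exists>f. ?P 0 f" using X by (intro exI[of _ "(X, 1)"]) simp
      fix f n assume P: "?P n f"
      obtain Y s where f: "f = (Y, s)" by force
      have Y: "Y \<in> L2 M" "0 < s" "s \<le> (1/2)^n" using P f by auto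
      then have "0 < s / 4" by simp
      then have "\<not> (\<forall>Z\<in>L2 M. L2_dist M Y Z < s / 4 \<longrightarrow> p Z \<le> real n)"
        using neg Y(1) by blast
      then obtain Y' where Y': "Y' \<in> L2 M" "L2_dist M Y Y' < s / 4" "real n < p Y'"
        by (auto simp: not_le)
      obtain t where t: "0 < t" "\<And>Z. Z \<in> L2 M \<Longrightarrow> L2_dist M Y' Z < t \<Longrightarrow> real n < p Z"
        using p_lsc[OF Y'(1,3)] by blast
      \<comment> \<open>The centre moves by less than \<open>s / 4\<close> and the new radius is at
        most \<open>s / 4\<close>, so the new ball stays within half of the old one.\<close>
      have "?P (Suc n) (Y', min t (s / 4))" "?Q n f (Y', min t (s / 4))"
        using Y Y' t by (auto simp: f)
      then show "\<exists>f'. ?P (Suc n) f' \<and> ?Q n f f'" by blast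
    qed
    then obtain f where f: "\<forall>n. ?P n (f n) \<and> ?Q n (f n) (f (Suc n))" by (rule exE)
    define Y where "Y n = fst (f n)" for n
    define s where "s n = snd (f n)" for n
    have Y: "Y n \<in> L2 M" and s: "0 < s n" "s n \<le> (1/2)^n" for n
      using spec[OF f, of n] by (auto simp: Y_def s_def split: prod.splits)
    have step: "L2_dist M (Y n) (Y (Suc n)) + s (Suc n) \<le> s n / 2"
      and big: "\<And>Z. Z \<in> L2 M \<Longrightarrow> L2_dist M (Y (Suc n)) Z < s (Suc n) \<Longrightarrow> real n < p Z" for n
      using spec[OF f, of n] by (auto simp: Y_def s_def split: prod.splits)
    have "L2_dist M (Y (Suc n)) (Y n) \<le> (1/2)^n" for n
      using step[of n] s[of n] s[of "Suc n"] L2_dist_commute[of M "Y n" "Y (Suc n)"] by linarith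
    then obtain W where W: "W \<in> L2 M" "\<And>n. L2_dist M (Y n) W \<le> 2 * (1/2)^n"
      using L2_complete[of Y, OF Y] by blast
    have nest: "L2_dist M (Y n) (Y (n + k)) + s (n + k) \<le> s n" for n k
    proof (induction k)
      case (Suc k)
      have "L2_dist M (Y n) (Y (n + Suc k)) \<le> L2_dist M (Y n) (Y (n + k)) + L2_dist M (Y (n + k)) (Y (n + Suc k))"
        by (intro L2_dist_triangle Y)
      with Suc step[of "n + k"] s(1)[of "n + k"] show ?case by simp
    qed simp
    \<comment> \<open>Half of the radius puts the limit strictly inside every open ball, so
      \<open>p W\<close> exceeds every \<open>n\<close>.\<close>
    have close: "L2_dist M (Y n) W \<le> s n / 2" for n
    proof (rule LIMSEQ_le_const[of "\<lambda>k. s n / 2 + 2 * (1/2)^(Suc n + k)"])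
      have "(\<lambda>k. 2 * (1/2)^Suc n * (1/2::real)^k) \<longlonglongrightarrow> 2 * (1/2)^Suc n * 0"
        by (intro tendsto_intros LIMSEQ_power_zero) auto
      then have "(\<lambda>k. s n / 2 + 2 * (1/2)^Suc n * (1/2::real)^k) \<longlonglongrightarrow> s n / 2 + 0"
        by (intro tendsto_intros) simp
      then show "(\<lambda>k. s n / 2 + 2 * (1/2)^(Suc n + k)) \<longlonglongrightarrow> s n / 2"
        by (simp add: power_add mult.assoc)
      have "L2_dist M (Y n) W \<le> s n / 2 + 2 * (1/2)^(Suc n + k)" for k
        using L2_dist_triangle[OF Y[of n] Y[of "Suc n"] W(1)]
          L2_dist_triangle[OF Y[of "Suc n"] Y[of "Suc n + k"] W(1)]
          W(2)[of "Suc n + k"] nest[of "Suc n" k] step[of n] s(1)[of "Suc n + k"] by linarith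
      then show "\<exists>N. \<forall>k\<ge>N. L2_dist M (Y n) W \<le> s n / 2 + 2 * (1/2)^(Suc n + k)" by blast
    qed
    have "real n < p W" for n
      using big[OF W(1), of n] close[of "Suc n"] s(1)[of "Suc n"] by linarith
    then show False using reals_Archimedean2[of "p W"] less_asym by blast
  qed
  then obtain n Y r where Y: "Y \<in> L2 M" and r: "0 < r"
    and bound: "\<And>Z. Z \<in> L2 M \<Longrightarrow> L2_dist M Y Z < r \<Longrightarrow> p Z \<le> real n" by blast
  show thesis
  proof (rule that[OF r])
    fix Z :: "'a \<Rightarrow> 'b" assume Z: "Z \<in> L2 M" "L2_norm M Z < r"
    have 1: "p (\<lambda>\<omega>. Y \<omega> + Z \<omega>) \<le> real n"
      using Z Y by (intro bound) (auto simp: L2_dist_def L2_add)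
    \<comment> \<open>\<open>Z\<close> is the midpoint of \<open>Y + Z\<close> and
      \<open>Z - Y\<close>; the second is the reflection of \<open>Y - Z\<close>, which lies in the
      ball around \<open>Y\<close>.\<close>
    have 2: "p (\<lambda>\<omega>. Z \<omega> - Y \<omega>) \<le> real n"
    proof -
      have "p (\<lambda>\<omega>. Y \<omega> - Z \<omega>) \<le> real n"
        using Z Y by (intro bound) (auto simp: L2_dist_def L2_diff)
      then show ?thesis using p_even[of "\<lambda>\<omega>. Y \<omega> - Z \<omega>"] by simp
    qed
    have "(\<lambda>\<omega>. (1/2) *\<^sub>R ((Y \<omega> + Z \<omega>) + (Z \<omega> - Y \<omega>))) = Z"
      by (simp add: fun_eq_iff flip: scaleR_2)
    then have "p Z \<le> real n"
      using p_mid[OF L2_add[OF Y Z(1)] L2_diff[OF Z(1) Y]] 1 2 by simp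
    then show "\<rho> (\<lambda>\<omega>. X \<omega> + Z \<omega>) \<le> real n" by (simp add: p_def)
  qed
qed

text \<open>Only the upper estimate needs work: a point near \<open>X\<close> is a convex
  combination of \<open>X\<close> and a point of the ball where \<open>\<rho>\<close> is bounded by
  \<open>B\<close>, with small weight \<open>t\<close> on the latter.\<close>

lemma (in prob_space) convex_lsc_continuous:
  fixes \<rho> :: "('a \<Rightarrow> 'b::euclidean_space) \<Rightarrow> real"
  assumes lsc: "lsc_functional M \<rho>" and conv: "convex_functional M \<rho>"
  shows "continuous_functional M \<rho>"
  unfolding continuous_functional_def
proof (intro ballI allI impI)
  fix X :: "'a \<Rightarrow> 'b" and e :: real assume X: "X \<in> L2 M" and e: "0 < e"
  obtain r B where r: "0 < r" and B: "\<And>Y. Y \<in> L2 M \<Longrightarrow> L2_norm M Y < r \<Longrightarrow> \<rho> (\<lambda>\<omega>. X \<omega> + Y \<omega>) \<le> B"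
    using convex_lsc_locally_bounded[OF lsc conv X] by blast
  obtain d where d: "0 < d" "\<And>Y. Y \<in> L2 M \<Longrightarrow> L2_dist M X Y < d \<Longrightarrow> \<rho> X - e < \<rho> Y"
    using lsc X e unfolding lsc_functional_def by blast
  \<comment> \<open>Small enough for \<open>t * (B - \<rho> X) < e\<close>, and at most 1 to serve
    as a convex weight.\<close>
  define t where "t = min 1 (e / (2 * (\<bar>B - \<rho> X\<bar> + 1)))"
  have t: "0 < t" "t \<le> 1" using e by (simp_all add: t_def add_nonneg_pos divide_pos_pos)
  have tB: "t * (B - \<rho> X) < e"
  proof -
    have "t * (2 * (\<bar>B - \<rho> X\<bar> + 1)) \<le> e / (2 * (\<bar>B - \<rho> X\<bar> + 1)) * (2 * (\<bar>B - \<rho> X\<bar> + 1))"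
      unfolding t_def by (intro mult_right_mono) auto
    moreover have "0 < 2 * (\<bar>B - \<rho> X\<bar> + 1)" by (simp add: add_nonneg_pos)
    ultimately have "t * (2 * (\<bar>B - \<rho> X\<bar> + 1)) \<le> e" by simp
    moreover have "t * (B - \<rho> X) \<le> t * \<bar>B - \<rho> X\<bar>" using t by (intro mult_left_mono) auto
    moreover have "0 \<le> t * \<bar>B - \<rho> X\<bar>" using t by simp
    moreover have "t * (2 * (a + 1)) = 2 * (t * a) + 2 * t" for a by (simp add: algebra_simps)
    note this[of "\<bar>B - \<rho> X\<bar>"]
    ultimately show ?thesis using t(1) by linarith
  qed
  have "\<bar>\<rho> Y - \<rho> X\<bar> < e" if Y: "Y \<in> L2 M" "L2_dist M X Y < min d (t * r)" for Y
  proof -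
    define Z where "Z \<omega> = (1/t) *\<^sub>R (Y \<omega> - X \<omega>)" for \<omega>
    have Z: "Z \<in> L2 M" unfolding Z_def[abs_def] by (intro L2_intros X Y)
    have "L2_norm M Z = L2_dist M X Y / t"
      using t L2_norm_scaleR[of M "1/t" "\<lambda>\<omega>. Y \<omega> - X \<omega>"]
      by (simp add: Z_def[abs_def] L2_dist_def norm_minus_commute)
    then have "t * L2_norm M Z < t * r" using Y t by simp
    then have "L2_norm M Z < r" by (rule mult_left_less_imp_less) (use t in simp)
    then have "\<rho> (\<lambda>\<omega>. X \<omega> + Z \<omega>) \<le> B" by (rule B[OF Z])
    moreover have "(\<lambda>\<omega>. t *\<^sub>R (X \<omega> + Z \<omega>) + (1 - t) *\<^sub>R X \<omega>) = Y"
      using t by (simp add: Z_def fun_eq_iff scaleR_right_distrib scaleR_left_diff_distrib)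
    then have "\<rho> Y \<le> t * \<rho> (\<lambda>\<omega>. X \<omega> + Z \<omega>) + (1 - t) * \<rho> X"
      using conv[unfolded convex_functional_def, rule_format, OF L2_add[OF X Z] X, of t] t by simp
    moreover have "t * \<rho> (\<lambda>\<omega>. X \<omega> + Z \<omega>) \<le> t * B"
      using \<open>\<rho> (\<lambda>\<omega>. X \<omega> + Z \<omega>) \<le> B\<close> t by (intro mult_left_mono) auto
    ultimately have "\<rho> Y - \<rho> X \<le> t * (B - \<rho> X)"
      by (simp add: algebra_simps)
    then show ?thesis using tB d(2)[OF Y(1)] Y(2) by simp
  qed
  then show "\<exists>\<delta>>0. \<forall>Y\<in>L2 M. L2_dist M X Y < \<delta> \<longrightarrow> \<bar>\<rho> Y - \<rho> X\<bar> < e"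
    using d(1) t r by (intro exI[of _ "min d (t * r)"]) auto
qed

section \<open>Semidiscrete optimal transport\<close>

lemma eventually_less_if_tendsto_less:
  fixes f g :: "'a \<Rightarrow> real"
  assumes "(f \<longlongrightarrow> a) F" "(g \<longlongrightarrow> b) F" "a < b"
  shows "eventually (\<lambda>x. f x < g x) F"
  using order_tendstoD(1)[OF tendsto_diff[OF assms(2,1)], of 0] assms(3) by simp

lemma ex_maximal_index:
  fixes f :: "nat \<Rightarrow> real"
  assumes "0 < n"
  shows "\<exists>i<n. \<forall>j<n. f j \<le> f i"
proof -
  have "Max (f ` {..<n}) \<in> f ` {..<n}"
    using assms by (intro Max_in) auto
  then obtain i where i: "i < n" "Max (f ` {..<n}) = f i" by auto
  have "f j \<le> f i" if "j < n" for j
    unfolding i(2)[symmetric] using that by (intro Max_ge) auto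
  then show ?thesis using i(1) by blast
qed

text \<open>The Laguerre cells of weighted points. Strict inequalities make them open and disjoint;
  for distinct points the uncovered ties lie on finitely many hyperplanes.\<close>

definition power_cell :: "nat \<Rightarrow> (nat \<Rightarrow> 'b::euclidean_space) \<Rightarrow> (nat \<Rightarrow> real) \<Rightarrow> nat \<Rightarrow> 'b set" where
  "power_cell n x h i = {u. \<forall>j<n. j \<noteq> i \<longrightarrow> x j \<bullet> u - h j < x i \<bullet> u - h i}"

lemma power_cell_borel [measurable]: "power_cell n x h i \<in> sets borel"
proof -
  have "power_cell n x h i = (\<Inter>j\<in>{j. j < n \<and> j \<noteq> i}. {u. x j \<bullet> u - h j < x i \<bullet> u - h i})"
    by (auto simp: power_cell_def)
  also have "open \<dots>"
    by (intro open_INT ballI open_Collect_less continuous_intros) auto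
  finally show ?thesis by simp
qed

text \<open>Semidiscrete optimal transport. Among the weights \<open>h\<close> with \<open>h 0 = 0\<close> for which no cell but
  the zeroth is too large, one of least sum gives every cell the prescribed measure: if the
  \<open>i\<close>-th cell were too small, \<open>h i\<close> could be decreased.\<close>

lemma power_cells_prescribed_measure:
  fixes \<mu> :: "'b::euclidean_space measure" and x :: "nat \<Rightarrow> 'b" and p :: "nat \<Rightarrow> real"
  assumes \<mu>: "prob_space \<mu>" "sets \<mu> = sets borel"
    and hyper: "\<And>a b. a \<noteq> 0 \<Longrightarrow> {u. a \<bullet> u = b} \<in> null_sets \<mu>"
    and inj: "inj_on x {..<n}" and p: "\<And>i. i < n \<Longrightarrow> 0 < p i" "(\<Sum>i<n. p i) = 1"
  obtains h where "\<And>i. i < n \<Longrightarrow> measure \<mu> (power_cell n x h i) = p i"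
    and "AE u in \<mu>. \<exists>i<n. u \<in> power_cell n x h i"
proof -
  interpret prob_space \<mu> by fact
  note [measurable_cong] = \<mu>(2)
  have space: "space \<mu> = UNIV" using sets_eq_imp_space_eq[OF \<mu>(2)] by simp
  have n: "0 < n" using p(2) by (cases n) auto
  have cell[measurable]: "power_cell n x h i \<in> events" for h i unfolding \<mu>(2) by measurable
  let ?G = "\<lambda>h i. measure \<mu> (power_cell n x h i)"
  have no_ties: "AE u in \<mu>. \<forall>i<n. \<forall>j<n. j \<noteq> i \<longrightarrow> x j \<bullet> u - h j \<noteq> x i \<bullet> u - h i" for h
  proof -
    have tie: "AE u in \<mu>. x j \<bullet> u - h j \<noteq> x i \<bullet> u - h i" if "i < n" "j < n" "j \<noteq> i" for i j
    proof (rule AE_I')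
      have "x j - x i \<noteq> 0" using inj that by (auto simp: inj_on_def)
      then show "{u. (x j - x i) \<bullet> u = h j - h i} \<in> null_sets \<mu>" by (rule hyper)
    qed (auto simp: inner_diff_left)
    have "AE u in \<mu>. \<forall>i\<in>{..<n}. \<forall>j\<in>{..<n}. j \<noteq> i \<longrightarrow> x j \<bullet> u - h j \<noteq> x i \<bullet> u - h i"
      using tie by (auto intro!: AE_finite_allI)
    then show ?thesis by (simp only: Ball_def lessThan_iff)
  qed
  have cover: "AE u in \<mu>. \<exists>i<n. u \<in> power_cell n x h i" for h
    using no_ties[of h]
  proof eventually_elim
    fix u assume nt: "\<forall>i<n. \<forall>j<n. j \<noteq> i \<longrightarrow> x j \<bullet> u - h j \<noteq> x i \<bullet> u - h i"
    obtain i where i: "i < n" "\<And>j. j < n \<Longrightarrow> x j \<bullet> u - h j \<le> x i \<bullet> u - h i"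
      using ex_maximal_index[OF n, of "\<lambda>j. x j \<bullet> u - h j"] by blast
    then have "u \<in> power_cell n x h i"
      unfolding power_cell_def using nt by (fastforce simp: less_le)
    then show "\<exists>i<n. u \<in> power_cell n x h i" using i by blast
  qed
  have disj: "disjoint_family_on (power_cell n x h) {..<n}" for h
    by (fastforce simp: disjoint_family_on_def power_cell_def)
  have total: "(\<Sum>i<n. ?G h i) = 1" for h
  proof -
    have "(\<Sum>i<n. ?G h i) = prob (\<Union>i<n. power_cell n x h i)"
      by (rule finite_measure_finite_Union[symmetric]) (auto simp: disj)
    also have "\<dots> = 1"
      using cover[of h] by (subst prob_eq_1) auto
    finally show ?thesis .
  qed
  \<comment> \<open>Away from ties, membership in a cell is eventually constant along convergent
    weights, so dominated convergence applies.\<close>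
  have G_lim: "(\<lambda>k. ?G (h k) i) \<longlonglongrightarrow> ?G h' i"
    if h: "\<And>j. (\<lambda>k. h k j) \<longlonglongrightarrow> h' j" and i: "i < n" for h h' i
  proof -
    have "(\<lambda>k. \<integral>u. indicator (power_cell n x (h k) i) u \<partial>\<mu>) \<longlonglongrightarrow> (\<integral>u. (indicator (power_cell n x h' i) u :: real) \<partial>\<mu>)"
    proof (rule integral_dominated_convergence[where w="\<lambda>_. 1"])
      show "AE u in \<mu>. (\<lambda>k. indicator (power_cell n x (h k) i) u :: real) \<longlonglongrightarrow> indicator (power_cell n x h' i) u"
        using no_ties[of h']
      proof eventually_elim
        fix u assume nt: "\<forall>i<n. \<forall>j<n. j \<noteq> i \<longrightarrow> x j \<bullet> u - h' j \<noteq> x i \<bullet> u - h' i"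
        have lim: "(\<lambda>k. x j \<bullet> u - h k j) \<longlonglongrightarrow> x j \<bullet> u - h' j" for j
          by (intro tendsto_intros h)
        have "eventually (\<lambda>k. u \<in> power_cell n x (h k) i \<longleftrightarrow> u \<in> power_cell n x h' i) sequentially"
        proof (cases "u \<in> power_cell n x h' i")
          case True
          have "eventually (\<lambda>k. x j \<bullet> u - h k j < x i \<bullet> u - h k i) sequentially" if "j < n" "j \<noteq> i" for j
            using True that by (intro eventually_less_if_tendsto_less[OF lim lim]) (auto simp: power_cell_def)
          then have "eventually (\<lambda>k. \<forall>j\<in>{j. j < n \<and> j \<noteq> i}. x j \<bullet> u - h k j < x i \<bullet> u - h k i) sequentially"
            by (intro eventually_ball_finite) auto
          then show ?thesis by eventually_elim (use True in \<open>auto simp: power_cell_def\<close>)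
        next
          case False
          then obtain j where j: "j < n" "j \<noteq> i" "x i \<bullet> u - h' i < x j \<bullet> u - h' j"
            using nt i by (fastforce simp: power_cell_def not_less less_le)
          then have "eventually (\<lambda>k. x i \<bullet> u - h k i < x j \<bullet> u - h k j) sequentially"
            by (intro eventually_less_if_tendsto_less[OF lim lim])
          then show ?thesis by eventually_elim (use False j in \<open>auto simp: power_cell_def intro!: exI[of _ j]\<close>)
        qed
        then show "(\<lambda>k. indicator (power_cell n x (h k) i) u :: real) \<longlonglongrightarrow> indicator (power_cell n x h' i) u"
          by (intro tendsto_eventually) (auto elim!: eventually_mono simp: indicator_def)
      qed
    qed (auto simp: indicator_def)
    then show ?thesis by simp
  qed
  define m where "m = Min (p ` {..<n})"
  have m: "0 < m" "\<And>i. i < n \<Longrightarrow> m \<le> p i"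
  proof -
    have "finite (p ` {..<n})" "p ` {..<n} \<noteq> {}" using n by auto
    then show "0 < m" unfolding m_def using p(1) by (subst Min_gr_iff) auto
  qed (auto simp: m_def)
  obtain r where r: "0 < r" "measure \<mu> {u. r < norm u} < m"
  proof -
    have "(\<lambda>k. measure \<mu> {u. real k < norm u}) \<longlonglongrightarrow> measure \<mu> (\<Inter>k. {u. real k < norm u})"
      by (intro finite_Lim_measure_decseq) (auto simp: decseq_def \<mu>(2))
    moreover have "(\<Inter>k. {u::'b. real k < norm u}) = {}"
    proof -
      have "\<exists>k. \<not> real k < norm u" for u :: 'b
        using real_arch_simple[of "norm u"] by (auto simp: not_less)
      then show ?thesis by blast
    qed
    ultimately have "eventually (\<lambda>k. measure \<mu> {u. real k < norm u} < m) sequentially"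
      using m(1) by (auto intro: order_tendstoD)
    then obtain k where k: "measure \<mu> {u. real k < norm u} < m"
      by (auto simp: eventually_sequentially)
    have "measure \<mu> {u. real (Suc k) < norm u} \<le> measure \<mu> {u. real k < norm u}"
      by (intro finite_measure_mono) (auto simp: \<mu>(2))
    then show thesis using k that[of "real (Suc k)"] by simp
  qed
  \<comment> \<open>If \<open>(x i - x 0) \<bullet> u\<close> exceeds \<open>R\<close> in absolute
    value, then \<open>u\<close> lies outside the ball of radius \<open>r\<close>, whose complement
    has less mass than any prescribed \<open>p i\<close>.\<close>
  define R where "R = (\<Sum>i<n. norm (x i - x 0)) * r"
  have R0: "0 \<le> R" using r by (auto simp: R_def intro!: mult_nonneg_nonneg sum_nonneg)
  have far: "measure \<mu> A < m"
    if "A \<in> events" "i < n" "\<And>u. u \<in> A \<Longrightarrow> R < \<bar>(x i - x 0) \<bullet> u\<bar>" for A i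
  proof -
    have "r < norm u" if u: "u \<in> A" for u
    proof -
      have "R < norm (x i - x 0) * norm u"
        using that(1) \<open>\<And>u. u \<in> A \<Longrightarrow> R < \<bar>(x i - x 0) \<bullet> u\<bar>\<close>[OF u]
          Cauchy_Schwarz_ineq2[of "x i - x 0" u] by linarith
      also have "\<dots> \<le> (\<Sum>i<n. norm (x i - x 0)) * norm u"
        using \<open>i < n\<close> by (intro mult_right_mono member_le_sum) auto
      finally show ?thesis
        unfolding R_def by (rule mult_left_less_imp_less) (simp add: sum_nonneg)
    qed
    then have "measure \<mu> A \<le> measure \<mu> {u. r < norm u}"
      by (intro finite_measure_mono) (auto simp: \<mu>(2))
    then show ?thesis using r(2) by simp
  qed
  \<comment> \<open>Coordinates other than \<open>0 < i < n\<close> are pinned to 0, so that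
    \<open>S\<close> is a product of compact sets in the function space and no finite-dimensional
    weight space is required.\<close>
  define S where "S = PiE UNIV (\<lambda>i. if 0 < i \<and> i < n then {-R..R} else {0::real})"
  define K where "K = {h\<in>S. \<forall>i\<in>{0<..<n}. ?G h i \<le> p i}"
  have coord_cont: "continuous_on UNIV (\<lambda>h::nat \<Rightarrow> real. h i)" for i
    by (rule continuous_on_product_coordinates)
  have coord_lim: "(\<lambda>k. f k i) \<longlonglongrightarrow> h i" if "f \<longlonglongrightarrow> h" for f :: "nat \<Rightarrow> nat \<Rightarrow> real" and h i
    using continuous_on_tendsto_compose[OF coord_cont that] by simp
  have G_cont: "continuous_on UNIV (\<lambda>h. ?G h i)" if "i < n" for i
    unfolding continuous_on_sequentially comp_def using G_lim that coord_lim by blast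
  have "compact S"
  proof -
    have "compactin (product_topology (\<lambda>_. euclidean) UNIV) S"
      unfolding S_def compactin_PiE by auto
    then show ?thesis by (simp add: euclidean_product_topology)
  qed
  moreover have "closed {h. \<forall>i\<in>{0<..<n}. ?G h i \<le> p i}"
  proof -
    have "{h. \<forall>i\<in>{0<..<n}. ?G h i \<le> p i} = (\<Inter>i\<in>{0<..<n}. {h. ?G h i \<le> p i})" by auto
    then show ?thesis by (auto intro!: closed_INT closed_Collect_le G_cont continuous_on_const)
  qed
  ultimately have "compact K"
    unfolding K_def by (simp add: compact_Int_closed Collect_conj_eq)
  moreover have "K \<noteq> {}"
  proof -
    \<comment> \<open>With every weight at \<open>R\<close>, each cell but the zeroth is far out and
      has mass below \<open>m\<close>.\<close>
    let ?h = "\<lambda>i. if 0 < i \<and> i < n then R else 0"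
    have "?G ?h i \<le> p i" if i: "0 < i" "i < n" for i
    proof -
      have "?G ?h i < m"
      proof (rule far)
        fix u assume "u \<in> power_cell n x ?h i"
        then have "x 0 \<bullet> u < x i \<bullet> u - R" using i n by (auto simp: power_cell_def)
        then show "R < \<bar>(x i - x 0) \<bullet> u\<bar>" by (simp add: inner_diff_left)
      qed (use i in auto)
      then show ?thesis using m(2)[OF i(2)] by simp
    qed
    then have "?h \<in> K" using R0 by (auto simp: K_def S_def)
    then show ?thesis by blast
  qed
  moreover have "continuous_on K (\<lambda>h. \<Sum>i<n. h i)"
    by (intro continuous_on_sum continuous_on_subset[OF coord_cont]) auto
  ultimately obtain h where h: "h \<in> K" and min: "\<And>h'. h' \<in> K \<Longrightarrow> (\<Sum>i<n. h i) \<le> (\<Sum>i<n. h' i)"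
    using continuous_attains_inf[of K "\<lambda>h. \<Sum>i<n. h i"] by blast
  have hS: "h i = 0" if "\<not> (0 < i \<and> i < n)" for i
    using h that by (auto simp: K_def S_def PiE_iff dest: spec[of _ i])
  have hR: "- R \<le> h i \<and> h i \<le> R" if "0 < i" "i < n" for i
    using h that by (auto simp: K_def S_def PiE_iff dest: spec[of _ i])
  have Gle: "?G h i \<le> p i" if "0 < i" "i < n" for i using h that by (auto simp: K_def)
  have split0: "(\<Sum>i<n. f i) = f 0 + (\<Sum>i\<in>{0<..<n}. f i)" for f :: "nat \<Rightarrow> real"
  proof -
    have "{..<n} - {0} = {0<..<n}" by auto
    then show ?thesis using n by (simp add: sum.remove[of "{..<n}" 0])
  qed
  have G0: "p 0 \<le> ?G h 0"
  proof -
    have "(\<Sum>i\<in>{0<..<n}. ?G h i) \<le> (\<Sum>i\<in>{0<..<n}. p i)"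
      using Gle by (intro sum_mono) auto
    then show ?thesis using total[of h] p(2) by (simp add: split0)
  qed
  have Geq: "?G h i = p i" if i: "0 < i" "i < n" for i
  proof (rule ccontr)
    assume "?G h i \<noteq> p i"
    then have less: "?G h i < p i" using Gle[OF i] by simp
    \<comment> \<open>At \<open>- R\<close> the zeroth cell would be far out, with less mass than
      \<open>p 0\<close>; hence there is room to decrease \<open>h i\<close>.\<close>
    have "h i \<noteq> - R"
    proof
      assume hi: "h i = - R"
      have "?G h 0 < m"
      proof (rule far[OF _ i(2)])
        fix u assume "u \<in> power_cell n x h 0"
        then have "x i \<bullet> u + R < x 0 \<bullet> u" using i hi hS[of 0] by (auto simp: power_cell_def)
        then show "R < \<bar>(x i - x 0) \<bullet> u\<bar>" by (simp add: inner_diff_left)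
      qed auto
      then show False using G0 m(2)[OF n] by simp
    qed
    then have pos: "0 < h i + R" using hR[OF i] by simp
    \<comment> \<open>Decreasing \<open>h i\<close> by a fraction of its distance to
      \<open>- R\<close> stays in the box; for large \<open>k\<close>, continuity keeps the
      \<open>i\<close>-th cell below \<open>p i\<close>.\<close>
    define g where "g k = h(i := h i - (h i + R) / real (Suc k))" for k
    have "(\<lambda>k. h i - (h i + R) / real (Suc k)) \<longlonglongrightarrow> h i - 0"
      by (intro tendsto_intros LIMSEQ_Suc[OF lim_const_over_n])
    then have "(\<lambda>k. g k j) \<longlonglongrightarrow> h j" for j by (cases "j = i") (simp_all add: g_def)
    then have "(\<lambda>k. ?G (g k) i) \<longlonglongrightarrow> ?G h i" by (rule G_lim[OF _ i(2)])
    then have "eventually (\<lambda>k. ?G (g k) i < p i) sequentially" using less by (rule order_tendstoD)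
    then obtain k where k: "?G (g k) i < p i" by (auto simp: eventually_sequentially)
    have le: "(h i + R) / real (Suc k) \<le> h i + R" "0 < (h i + R) / real (Suc k)"
      using pos mult_nonneg_nonneg[of "real k" "h i + R"] by (auto simp: field_simps)
    have "g k \<in> K"
    proof -
      have "g k \<in> S"
      proof -
        have "g k j \<in> (if 0 < j \<and> j < n then {-R..R} else {0})" for j
        proof (cases "j = i")
          case True
          then show ?thesis using i le hR[OF i] unfolding g_def by auto
        next
          case False
          then show ?thesis using hR[of j] hS[of j] by (auto simp: g_def)
        qed
        then show ?thesis by (simp add: S_def PiE_iff)
      qed
      moreover have "?G (g k) j \<le> p j" if j: "0 < j" "j < n" for j
      proof (cases "j = i")
        case False
        \<comment> \<open>Lowering \<open>h i\<close> raises the \<open>i\<close>-th affine function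
          only, which shrinks all other cells.\<close>
        have "power_cell n x (g k) j \<subseteq> power_cell n x h j"
          using False le i unfolding power_cell_def g_def by (fastforce split: if_splits)
        then have "?G (g k) j \<le> ?G h j" by (intro finite_measure_mono) auto
        then show ?thesis using Gle[OF j] by simp
      qed (use k in simp)
      ultimately show ?thesis by (auto simp: K_def)
    qed
    then have "(\<Sum>j<n. h j) \<le> (\<Sum>j<n. g k j)" by (rule min)
    also have "\<dots> < (\<Sum>j<n. h j)"
      using i le by (intro sum_strict_mono_ex1) (auto simp: g_def)
    finally show False by simp
  qed
  have "?G h 0 = p 0"
  proof -
    have "(\<Sum>i\<in>{0<..<n}. ?G h i) = (\<Sum>i\<in>{0<..<n}. p i)"
      using Geq by (intro sum.cong) auto
    then show ?thesis using total[of h] p(2) by (simp add: split0)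
  qed
  then have "?G h i = p i" if "i < n" for i using Geq that by (cases "i = 0") auto
  then show thesis using cover by (rule that)
qed

section \<open>Optimal couplings and subgradients\<close>

text \<open>Weak duality: \<open>le\<close> says that \<open>k\<close> is a subgradient of the
  potential \<open>\<phi>\<close> at \<open>U\<close>, and the mean of \<open>\<phi>\<close> is the
  same for all vectors with law \<open>\<mu>\<close>.\<close>

lemma (in prob_space) optimal_couplingI:
  fixes k :: "'a \<Rightarrow> 'b::euclidean_space"
  assumes U: "has_law M U \<mu>" and \<mu>: "\<mu> \<in> P2" and k: "k \<in> L2 M"
    and \<phi>[measurable]: "\<phi> \<in> borel_measurable borel" and int: "integrable M (\<lambda>\<omega>. \<phi> (U \<omega>))"
    and le: "\<And>\<omega> v. \<omega> \<in> space M \<Longrightarrow> k \<omega> \<bullet> v - \<phi> v \<le> k \<omega> \<bullet> U \<omega> - \<phi> (U \<omega>)"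
  shows "is_arg_max (correlation M k) (\<lambda>V. has_law M V \<mu>) U"
proof -
  have "correlation M k V \<le> correlation M k U" if V: "has_law M V \<mu>" for V
  proof -
    have VU: "same_law M V U" by (rule has_law_same_law[OF V U])
    have int': "integrable M (\<lambda>\<omega>. \<phi> (V \<omega>))"
      using same_law_integral(2)[OF VU \<phi>] int by simp
    have i: "integrable M (\<lambda>\<omega>. k \<omega> \<bullet> V \<omega>)" "integrable M (\<lambda>\<omega>. k \<omega> \<bullet> U \<omega>)"
      using k has_law_P2_L2[OF V \<mu>] has_law_P2_L2[OF U \<mu>] by (auto intro: L2_integrable_inner)
    have "expectation (\<lambda>\<omega>. k \<omega> \<bullet> V \<omega> - \<phi> (V \<omega>)) \<le> expectation (\<lambda>\<omega>. k \<omega> \<bullet> U \<omega> - \<phi> (U \<omega>))"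
      using le i int int' by (intro integral_mono) auto
    then show ?thesis
      using i int int' same_law_integral(1)[OF VU \<phi>] by (simp add: correlation_def)
  qed
  then show ?thesis using U by (auto simp: is_arg_max_def not_less)
qed

text \<open>The atoms in \<open>I\<close> bound the probability of a Borel set and of its complement
  from below; as their total mass is one, both bounds are equalities.\<close>

lemma (in prob_space) same_law_discreteI:
  fixes X Y :: "'a \<Rightarrow> 'b::euclidean_space"
  assumes [measurable]: "X \<in> borel_measurable M" "Y \<in> borel_measurable M"
    and I: "finite I" and eq: "\<And>x. x \<in> I \<Longrightarrow> prob (X -` {x} \<inter> space M) = prob (Y -` {x} \<inter> space M)"
    and one: "(\<Sum>x\<in>I. prob (X -` {x} \<inter> space M)) = 1"
  shows "same_law M X Y"
proof -
  have formula: "prob (Z -` B \<inter> space M) = (\<Sum>x\<in>I \<inter> B. prob (Z -` {x} \<inter> space M))"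
    if [measurable]: "Z \<in> borel_measurable M" and Z: "(\<Sum>x\<in>I. prob (Z -` {x} \<inter> space M)) = 1"
      and B[measurable]: "B \<in> sets borel" for Z B
  proof -
    have ge: "(\<Sum>x\<in>I \<inter> C. prob (Z -` {x} \<inter> space M)) \<le> prob (Z -` C \<inter> space M)" if [measurable]: "C \<in> sets borel" for C
    proof -
      have "(\<Sum>x\<in>I \<inter> C. prob (Z -` {x} \<inter> space M)) = prob (\<Union>x\<in>I \<inter> C. Z -` {x} \<inter> space M)"
        using I by (intro finite_measure_finite_Union[symmetric]) (auto simp: disjoint_family_on_def)
      also have "\<dots> \<le> prob (Z -` C \<inter> space M)"
        by (intro finite_measure_mono) auto
      finally show ?thesis .
    qed
    have "prob (Z -` (- B) \<inter> space M) = 1 - prob (Z -` B \<inter> space M)"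
    proof -
      have "Z -` (- B) \<inter> space M = space M - (Z -` B \<inter> space M)" by auto
      then show ?thesis by (simp add: prob_compl)
    qed
    moreover have "(\<Sum>x\<in>I. prob (Z -` {x} \<inter> space M))
        = (\<Sum>x\<in>I \<inter> B. prob (Z -` {x} \<inter> space M)) + (\<Sum>x\<in>I \<inter> - B. prob (Z -` {x} \<inter> space M))"
      using I by (subst sum.union_disjoint[symmetric]) (auto intro!: sum.cong)
    ultimately show ?thesis using ge[of B] ge[of "- B"] Z by auto
  qed
  have one': "(\<Sum>x\<in>I. prob (Y -` {x} \<inter> space M)) = 1" using one eq by simp
  have "distr M borel X = distr M borel Y"
  proof (rule measure_eqI)
    fix B assume "B \<in> sets (distr M borel X)"
    then have B[measurable]: "B \<in> sets borel" by simp
    have "prob (X -` B \<inter> space M) = prob (Y -` B \<inter> space M)"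
      using eq by (simp add: formula[OF _ one B] formula[OF _ one' B])
    then show "emeasure (distr M borel X) B = emeasure (distr M borel Y) B"
      by (simp add: emeasure_distr emeasure_eq_measure)
  qed simp
  then show ?thesis by (simp add: same_law_def)
qed

text \<open>\<open>k\<close> is a subgradient at \<open>U\<close> of the maximum of the affine
  functions \<open>x i \<bullet> v - h i\<close>, with weights chosen so that each value of
  \<open>X\<close> is taken with the right probability.\<close>

lemma (in prob_space) optimal_coupling_simple:
  fixes X U :: "'a \<Rightarrow> 'b::euclidean_space"
  assumes U: "has_law M U \<mu>" and \<mu>: "\<mu> \<in> P2"
    and hyper: "\<And>a b. a \<noteq> 0 \<Longrightarrow> {u. a \<bullet> u = b} \<in> null_sets \<mu>"
    and X: "simple_function M X"
  obtains k where "k \<in> L2 M" "same_law M k X" "is_arg_max (correlation M k) (\<lambda>V. has_law M V \<mu>) U"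
proof -
  have P\<mu>: "prob_space \<mu>" "sets \<mu> = sets borel" using \<mu> by (auto simp: P2_def)
  note [measurable_cong] = P\<mu>(2)
  have [measurable]: "U \<in> borel_measurable M" and U_law: "distr M borel U = \<mu>"
    using U by (auto simp: has_law_def)
  have Xm[measurable]: "X \<in> borel_measurable M" using X by (rule borel_measurable_simple_function)
  let ?p = "\<lambda>x. prob (X -` {x} \<inter> space M)"
  \<comment> \<open>The prescribed cell masses have to be positive, so values taken with probability
    zero are dropped.\<close>
  define I where "I = {x \<in> X ` space M. 0 < ?p x}"
  have fin: "finite (X ` space M)" using X by (rule simple_functionD)
  then have I: "finite I" by (simp add: I_def)
  have sumI: "(\<Sum>x\<in>I. ?p x) = 1"
  proof -
    have "(\<Sum>x\<in>I. ?p x) = (\<Sum>x\<in>X ` space M. ?p x)"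
      using fin by (intro sum.mono_neutral_left) (auto simp: I_def zero_less_measure_iff)
    also have "\<dots> = prob (\<Union>x\<in>X ` space M. X -` {x} \<inter> space M)"
      using fin by (intro finite_measure_finite_Union[symmetric]) (auto simp: disjoint_family_on_def)
    also have "(\<Union>x\<in>X ` space M. X -` {x} \<inter> space M) = space M" by auto
    finally show ?thesis by (simp add: prob_space)
  qed
  obtain x :: "nat \<Rightarrow> 'b" and n where x: "bij_betw x {..<n} I"
    using ex_bij_betw_nat_finite[OF I] unfolding lessThan_atLeast0[symmetric] by blast
  have inj: "inj_on x {..<n}" using x by (rule bij_betw_imp_inj_on)
  have xI: "x i \<in> I" if "i < n" for i using bij_betwE[OF x] that by simp
  have "(\<Sum>i<n. ?p (x i)) = 1" using sum.reindex_bij_betw[OF x, of ?p] sumI by simp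
  moreover have "0 < ?p (x i)" if "i < n" for i using xI[OF that] by (simp add: I_def)
  ultimately obtain h where h: "\<And>i. i < n \<Longrightarrow> measure \<mu> (power_cell n x h i) = ?p (x i)"
    and cover: "AE u in \<mu>. \<exists>i<n. u \<in> power_cell n x h i"
    using power_cells_prescribed_measure[OF P\<mu> hyper inj, of "\<lambda>i. ?p (x i)"] by auto
  have "I \<noteq> {}" using sumI by auto
  then have n: "0 < n" using x by (cases n) (auto simp: bij_betw_def)
  \<comment> \<open>\<open>LEAST\<close> breaks ties, which gives a measurable choice of maximiser
    at every point; off the null set of ties it is the index of the cell.\<close>
  define idx where "idx v = (LEAST i. i < n \<and> (\<forall>j\<in>{..<n}. x j \<bullet> v - h j \<le> x i \<bullet> v - h i))" for v
  have idx_meas[measurable]: "idx \<in> measurable borel (count_space UNIV)"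
    unfolding idx_def by measurable
  have idx: "idx v < n" "\<And>j. j < n \<Longrightarrow> x j \<bullet> v - h j \<le> x (idx v) \<bullet> v - h (idx v)" for v
  proof -
    have "\<exists>i. i < n \<and> (\<forall>j\<in>{..<n}. x j \<bullet> v - h j \<le> x i \<bullet> v - h i)"
      using ex_maximal_index[OF n, of "\<lambda>j. x j \<bullet> v - h j"] by auto
    then have "idx v < n \<and> (\<forall>j\<in>{..<n}. x j \<bullet> v - h j \<le> x (idx v) \<bullet> v - h (idx v))"
      unfolding idx_def by (rule LeastI_ex)
    then show "idx v < n" "\<And>j. j < n \<Longrightarrow> x j \<bullet> v - h j \<le> x (idx v) \<bullet> v - h (idx v)" by auto
  qed
  have idx_cell: "idx u = i" if "u \<in> power_cell n x h i" "i < n" for u i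
  proof (rule ccontr)
    assume ne: "idx u \<noteq> i"
    then have "x (idx u) \<bullet> u - h (idx u) < x i \<bullet> u - h i"
      using that idx(1)[of u] by (auto simp: power_cell_def)
    then show False using idx(2)[OF that(2), of u] by simp
  qed
  define k where "k \<omega> = x (idx (U \<omega>))" for \<omega>
  have [measurable]: "k \<in> borel_measurable M" unfolding k_def by measurable
  have bound: "norm (f (idx v)) \<le> (\<Sum>i<n. norm (f i))" for v and f :: "nat \<Rightarrow> 'd::real_normed_vector"
    using idx(1)[of v] by (intro member_le_sum) auto
  have k: "k \<in> L2 M"
    by (rule L2_bounded[of _ "\<Sum>i<n. norm (x i)"]) (auto simp: k_def bound)
  have law: "same_law M X k"
  proof (rule same_law_discreteI[OF _ _ I _ sumI])
    fix y assume "y \<in> I"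
    then obtain i where i: "i < n" "y = x i" using x by (auto simp: bij_betw_def)
    have [measurable]: "idx -` {i} \<in> sets borel"
      using measurable_sets[OF idx_meas, of "{i}"] by simp
    have "k -` {y} \<inter> space M = U -` (idx -` {i}) \<inter> space M"
      using i inj idx(1) by (auto simp: k_def inj_on_def)
    then have "prob (k -` {y} \<inter> space M) = measure \<mu> (idx -` {i})"
      unfolding U_law[symmetric] by (simp add: measure_distr)
    also have "\<dots> = measure \<mu> (power_cell n x h i)"
    proof (rule measure_eq_AE)
      show "AE u in \<mu>. (u \<in> idx -` {i}) = (u \<in> power_cell n x h i)"
        using cover by eventually_elim (use idx_cell i in auto)
    qed measurable
    also have "\<dots> = ?p y" using h i by simp
    finally show "?p y = prob (k -` {y} \<inter> space M)" by simp
  qed auto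
  have opt: "is_arg_max (correlation M k) (\<lambda>V. has_law M V \<mu>) U"
  proof (rule optimal_couplingI[OF U \<mu> k])
    let ?\<phi> = "\<lambda>v. x (idx v) \<bullet> v - h (idx v)"
    show "?\<phi> \<in> borel_measurable borel" by measurable
    have "(\<lambda>\<omega>. h (idx (U \<omega>))) \<in> L2 M"
      by (rule L2_bounded[OF _ bound]) measurable
    then have "integrable M (\<lambda>\<omega>. h (idx (U \<omega>)))" by (rule L2_integrable)
    then show "integrable M (\<lambda>\<omega>. ?\<phi> (U \<omega>))"
      using L2_integrable_inner[OF k has_law_P2_L2[OF U \<mu>]] by (simp add: k_def)
    fix \<omega> v
    show "k \<omega> \<bullet> v - ?\<phi> v \<le> k \<omega> \<bullet> U \<omega> - ?\<phi> (U \<omega>)"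
      using idx(2)[OF idx(1)[of "U \<omega>"], of v] by (simp add: k_def)
  qed
  show thesis using k same_law_sym[OF law] opt by (rule that)
qed

section \<open>Dense simple vectors and subgradients of sublinear functionals\<close>

lemma (in prob_space) L2_simple_dense:
  fixes X :: "'a \<Rightarrow> 'b::euclidean_space"
  assumes X: "X \<in> L2 M" and e: "0 < e"
  obtains Y where "simple_function M Y" "Y \<in> L2 M" "L2_dist M X Y < e"
proof -
  have Xm[measurable]: "X \<in> borel_measurable M" using X by (rule L2_borel)
  obtain s where s: "\<And>i. simple_function M (s i)" "\<And>\<omega>. \<omega> \<in> space M \<Longrightarrow> (\<lambda>i. s i \<omega>) \<longlonglongrightarrow> X \<omega>"
    and le: "\<And>i \<omega>. \<omega> \<in> space M \<Longrightarrow> dist (s i \<omega>) 0 \<le> 2 * dist (X \<omega>) 0"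
    using borel_measurable_implies_sequence_metric[OF Xm, of 0] by blast
  have [measurable]: "s i \<in> borel_measurable M" for i using s(1) by (rule borel_measurable_simple_function)
  have sL: "s i \<in> L2 M" for i
  proof -
    have "integrable M (\<lambda>\<omega>. (norm (s i \<omega>))\<^sup>2)"
    proof (rule Bochner_Integration.integrable_bound)
      show "integrable M (\<lambda>\<omega>. (norm (2 *\<^sub>R X \<omega>))\<^sup>2)" using L2_scaleR[OF X, of 2] by (simp add: L2_def)
      show "AE \<omega> in M. norm ((norm (s i \<omega>))\<^sup>2) \<le> norm ((norm (2 *\<^sub>R X \<omega>))\<^sup>2)"
      proof (rule AE_I2)
        fix \<omega> assume "\<omega> \<in> space M"
        then have "(norm (s i \<omega>))\<^sup>2 \<le> (2 * norm (X \<omega>))\<^sup>2"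
          using le[of \<omega> i] by (intro power_mono) auto
        then show "norm ((norm (s i \<omega>))\<^sup>2) \<le> norm ((norm (2 *\<^sub>R X \<omega>))\<^sup>2)" by simp
      qed
    qed measurable
    then show ?thesis by (simp add: L2_def)
  qed
  have "(\<lambda>i. \<integral>\<omega>. (norm (X \<omega> - s i \<omega>))\<^sup>2 \<partial>M) \<longlonglongrightarrow> (\<integral>\<omega>. 0 \<partial>M)"
  \<comment> \<open>The factor 3 is one for \<open>X\<close> plus two for the bound on
    \<open>s i\<close>.\<close>
  proof (rule integral_dominated_convergence[where w="\<lambda>\<omega>. (norm (3 *\<^sub>R X \<omega>))\<^sup>2"])
    show "integrable M (\<lambda>\<omega>. (norm (3 *\<^sub>R X \<omega>))\<^sup>2)" using L2_scaleR[OF X, of 3] by (simp add: L2_def)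
    show "AE \<omega> in M. (\<lambda>i. (norm (X \<omega> - s i \<omega>))\<^sup>2) \<longlonglongrightarrow> 0"
    proof (rule AE_I2)
      fix \<omega> assume "\<omega> \<in> space M"
      then have "(\<lambda>i. (norm (X \<omega> - s i \<omega>))\<^sup>2) \<longlonglongrightarrow> (norm (X \<omega> - X \<omega>))\<^sup>2"
        by (intro tendsto_intros s(2))
      then show "(\<lambda>i. (norm (X \<omega> - s i \<omega>))\<^sup>2) \<longlonglongrightarrow> 0" by simp
    qed
    show "AE \<omega> in M. norm ((norm (X \<omega> - s i \<omega>))\<^sup>2) \<le> (norm (3 *\<^sub>R X \<omega>))\<^sup>2" for i
    proof (rule AE_I2)
      fix \<omega> assume "\<omega> \<in> space M"
      then have "(norm (X \<omega> - s i \<omega>))\<^sup>2 \<le> (3 * norm (X \<omega>))\<^sup>2"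
        using le[of \<omega> i] norm_triangle_ineq4[of "X \<omega>" "s i \<omega>"] by (intro power_mono) auto
      then show "norm ((norm (X \<omega> - s i \<omega>))\<^sup>2) \<le> (norm (3 *\<^sub>R X \<omega>))\<^sup>2" by simp
    qed
  qed auto
  then have "(\<lambda>i. L2_dist M X (s i)) \<longlonglongrightarrow> 0"
    unfolding L2_dist_def using tendsto_real_sqrt by fastforce
  then have "eventually (\<lambda>i. L2_dist M X (s i) < e) sequentially" using e by (rule order_tendstoD)
  then obtain i where "L2_dist M X (s i) < e" by (auto simp: eventually_sequentially)
  then show thesis using that[OF s(1) sL] by blast
qed

text \<open>A minimising sequence of \<open>\<lambda>X. q X + (L2_norm M X)\<^sup>2 / 2\<close> is Cauchy by the parallelogram
  law, and minus its limit is a subgradient of \<open>q\<close> at \<open>0\<close>.\<close>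

lemma (in prob_space) sublinear_subgradient:
  fixes q :: "('a \<Rightarrow> 'b::euclidean_space) \<Rightarrow> real"
  assumes sub: "\<And>X Y. X \<in> L2 M \<Longrightarrow> Y \<in> L2 M \<Longrightarrow> q (\<lambda>\<omega>. X \<omega> + Y \<omega>) \<le> q X + q Y"
    and hom: "\<And>t X. 0 < t \<Longrightarrow> X \<in> L2 M \<Longrightarrow> q (\<lambda>\<omega>. t *\<^sub>R X \<omega>) \<le> t * q X"
    and zero: "0 \<le> q (\<lambda>_. 0)"
    and bound: "\<And>X. X \<in> L2 M \<Longrightarrow> q X \<le> C * L2_norm M X"
  obtains V where "V \<in> L2 M" "\<And>X. X \<in> L2 M \<Longrightarrow> correlation M X V \<le> q X"
proof -
  define F where "F X = q X + (L2_norm M X)\<^sup>2 / 2" for X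
  \<comment> \<open>Sublinearity gives \<open>q X\<close> at least \<open>- C * L2_norm M X\<close>;
    completing the square bounds \<open>F\<close>.\<close>
  have lower: "- C\<^sup>2 / 2 \<le> F X" if X: "X \<in> L2 M" for X
  proof -
    have "0 \<le> q X + q (\<lambda>\<omega>. - X \<omega>)" using sub[OF X L2_uminus[OF X]] zero by simp
    moreover have "q (\<lambda>\<omega>. - X \<omega>) \<le> C * L2_norm M X"
      using bound[OF L2_uminus[OF X]] by (simp add: L2_norm_uminus)
    moreover have "0 \<le> (L2_norm M X - C)\<^sup>2" by simp
    ultimately show ?thesis by (simp add: F_def power2_diff algebra_simps)
  qed
  have bdd: "bdd_below (F ` L2 M)" using lower by (intro bdd_belowI2) auto
  define m where "m = Inf (F ` L2 M)"
  have m_le: "m \<le> F X" if "X \<in> L2 M" for X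
    unfolding m_def using bdd that by (intro cInf_lower) auto
  \<comment> \<open>The tolerance makes the squared distance of consecutive terms at most
    \<open>4 * (1/8 + 1/8) * (1/4)^n\<close>, as \<open>L2_complete\<close> demands.\<close>
  have "\<exists>X\<in>L2 M. F X < m + (1/4)^n / 8" for n :: nat
  proof -
    have "m < m + (1/4)^n / 8" by simp
    moreover have "F ` L2 M \<noteq> {}" using L2_zero by blast
    ultimately show ?thesis using cInf_less_iff[OF _ bdd] unfolding m_def by blast
  qed
  then obtain X where X: "\<And>n. X n \<in> L2 M" and FX: "\<And>n. F (X n) < m + (1/4)^n / 8" by metis
  have "L2_dist M (X (Suc n)) (X n) \<le> (1/2)^n" for n
  proof (rule power2_le_imp_le)
    let ?Y = "X (Suc n)" and ?Z = "X n"
    have mid: "(\<lambda>\<omega>. (1/2) *\<^sub>R (?Y \<omega> + ?Z \<omega>)) \<in> L2 M" by (intro L2_intros X)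
    have "m \<le> F (\<lambda>\<omega>. (1/2) *\<^sub>R (?Y \<omega> + ?Z \<omega>))" by (rule m_le[OF mid])
    moreover have "q (\<lambda>\<omega>. (1/2) *\<^sub>R (?Y \<omega> + ?Z \<omega>)) \<le> (1/2) * (q ?Y + q ?Z)"
      using hom[of "1/2" "\<lambda>\<omega>. ?Y \<omega> + ?Z \<omega>"] sub[OF X[of "Suc n"] X[of n]] L2_add[OF X[of "Suc n"] X[of n]] by simp
    moreover have "(L2_norm M (\<lambda>\<omega>. (1/2) *\<^sub>R (?Y \<omega> + ?Z \<omega>)))\<^sup>2 = (L2_norm M ?Y)\<^sup>2 / 2 + (L2_norm M ?Z)\<^sup>2 / 2 - (L2_dist M ?Y ?Z)\<^sup>2 / 4"
      unfolding L2_dist_eq_norm[of M ?Y ?Z] L2_norm_square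
      by (simp add: correlation_simps X L2_intros correlation_commute[of M ?Z ?Y] field_simps)
    ultimately have "(L2_dist M ?Y ?Z)\<^sup>2 \<le> 4 * (F ?Y + F ?Z - 2 * m)"
      unfolding F_def by (simp add: field_simps)
    also have "\<dots> \<le> (1/4)^n"
    proof -
      have "F ?Y < m + (1/4)^n / 8"
        by (rule order_less_le_trans[OF FX[of "Suc n"]]) simp
      then show ?thesis using FX[of n] by argo
    qed
    also have "(1/4::real)^n = ((1/2)^n)\<^sup>2"
      by (simp add: power2_eq_square flip: power_mult_distrib)
    finally show "(L2_dist M ?Y ?Z)\<^sup>2 \<le> ((1/2)^n)\<^sup>2" .
  qed simp
  then obtain W where W: "W \<in> L2 M" "\<And>n. L2_dist M (X n) W \<le> 2 * (1/2)^n"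
    using L2_complete[of X, OF X] by blast
  have "- correlation M W Y \<le> q Y" if Y: "Y \<in> L2 M" for Y
  proof -
    let ?y = "(L2_norm M Y)\<^sup>2"
    \<comment> \<open>Near-minimality of \<open>X n\<close> against a perturbation of size
      \<open>t\<close> along \<open>Y\<close>. Letting \<open>n\<close> grow first removes the
      defect divided by \<open>t\<close>; then \<open>t\<close> tends to 0.\<close>
    have 1: "- correlation M (X n) Y - t / 2 * ?y - (1/4)^n / (8 * t) \<le> q Y" if t: "0 < t" for t n
    proof -
      have "m \<le> F (\<lambda>\<omega>. X n \<omega> + t *\<^sub>R Y \<omega>)" by (intro m_le L2_intros X Y)
      moreover have "q (\<lambda>\<omega>. X n \<omega> + t *\<^sub>R Y \<omega>) \<le> q (X n) + t * q Y"
        using sub[OF X[of n] L2_scaleR[OF Y, of t]] hom[OF t Y] by simp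
      moreover have "(L2_norm M (\<lambda>\<omega>. X n \<omega> + t *\<^sub>R Y \<omega>))\<^sup>2 = (L2_norm M (X n))\<^sup>2 + 2 * t * correlation M (X n) Y + t\<^sup>2 * ?y"
        unfolding L2_norm_square
        by (simp add: correlation_simps X Y L2_intros correlation_commute[of M Y "X n"] power2_eq_square algebra_simps)
      ultimately have "0 \<le> t * q Y + t * correlation M (X n) Y + t\<^sup>2 * ?y / 2 + (1/4)^n / 8"
        using FX[of n] unfolding F_def by linarith
      also have "\<dots> = t * (q Y + correlation M (X n) Y + t / 2 * ?y + (1/4)^n / (8 * t))"
        using t by (simp add: field_simps power2_eq_square)
      finally show ?thesis using t by (simp add: zero_le_mult_iff)
    qed
    have 2: "- correlation M W Y - t / 2 * ?y \<le> q Y" if t: "0 < t" for t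
    proof (rule LIMSEQ_le_const2)
      have "(\<lambda>n. correlation M (X n) Y) \<longlonglongrightarrow> correlation M W Y"
      proof (rule Lim_transform_bound[of "\<lambda>n. correlation M (X n) Y - correlation M W Y" "\<lambda>n. 2 * (1/2)^n * L2_norm M Y", THEN LIM_zero_cancel])
        show "\<forall>\<^sub>F n in sequentially. norm (correlation M (X n) Y - correlation M W Y) \<le> norm (2 * (1/2)^n * L2_norm M Y)"
        proof (rule always_eventually, rule allI)
          fix n
          have "\<bar>correlation M (\<lambda>\<omega>. X n \<omega> - W \<omega>) Y\<bar> \<le> L2_dist M (X n) W * L2_norm M Y"
            using correlation_Cauchy_Schwarz[OF L2_diff[OF X[of n] W(1)] Y] by (simp add: L2_dist_def)
          also have "\<dots> \<le> 2 * (1/2)^n * L2_norm M Y"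
            by (intro mult_right_mono W(2)) simp
          finally show "norm (correlation M (X n) Y - correlation M W Y) \<le> norm (2 * (1/2)^n * L2_norm M Y)"
            by (simp add: correlation_diff_left X W(1) Y)
        qed
        have "(\<lambda>n. 2 * (1/2::real)^n * L2_norm M Y) \<longlonglongrightarrow> 2 * 0 * L2_norm M Y"
          by (intro tendsto_intros LIMSEQ_power_zero) auto
        then show "(\<lambda>n. 2 * (1/2::real)^n * L2_norm M Y) \<longlonglongrightarrow> 0" by simp
      qed
      moreover have "(\<lambda>n. (1/4::real)^n) \<longlonglongrightarrow> 0" by (intro LIMSEQ_power_zero) auto
      ultimately have "(\<lambda>n. - correlation M (X n) Y - t / 2 * ?y - (1/4)^n / (8 * t)) \<longlonglongrightarrow> - correlation M W Y - t / 2 * ?y - 0 / (8 * t)"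
        using t by (intro tendsto_intros) auto
      then show "(\<lambda>n. - correlation M (X n) Y - t / 2 * ?y - (1/4)^n / (8 * t)) \<longlonglongrightarrow> - correlation M W Y - t / 2 * ?y" by simp
    qed (use 1[OF t] in blast)
    show ?thesis
    proof (rule tendsto_upperbound[of "\<lambda>t. - correlation M W Y - t / 2 * ?y" _ "at_right 0"])
      have "((\<lambda>t. - correlation M W Y - t / 2 * ?y) \<longlongrightarrow> - correlation M W Y - 0 / 2 * ?y) (at_right 0)"
        by (intro tendsto_intros) auto
      then show "((\<lambda>t. - correlation M W Y - t / 2 * ?y) \<longlongrightarrow> - correlation M W Y) (at_right 0)" by simp
      show "\<forall>\<^sub>F t in at_right 0. - correlation M W Y - t / 2 * ?y \<le> q Y"
        using eventually_at_right_less[of "0::real"] by eventually_elim (rule 2)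
    qed simp
  qed
  then show thesis
    using that[OF L2_uminus[OF W(1)]] by (simp add: correlation_uminus_right correlation_commute[of M _ W])
qed

section \<open>Comonotonic additive risk measures\<close>

locale comonotonic_risk_measure = prob_space M
  for M :: "'a measure" +
  fixes \<mu> :: "'b::euclidean_space measure" and \<rho> :: "('a \<Rightarrow> 'b) \<Rightarrow> real" and U :: "'a \<Rightarrow> 'b"
  assumes nonatomic: "nonatomic M"
    and \<mu>: "\<mu> \<in> P2" and hyperplane: "\<And>a b. a \<noteq> 0 \<Longrightarrow> {u. a \<bullet> u = b} \<in> null_sets \<mu>"
    and U: "has_law M U \<mu>"
    and lsc: "lsc_functional M \<rho>" and convex: "convex_functional M \<rho>"
    and law: "law_invariant M \<rho>" and additive: "comonotonic_additive M \<mu> \<rho>"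
begin

section \<open>The cone of optimally coupled vectors and the behaviour of the risk measure on
  it\<close>

definition optimal_cone :: "('a \<Rightarrow> 'b) set" where
  "optimal_cone = {k \<in> L2 M. is_arg_max (correlation M k) (\<lambda>V. has_law M V \<mu>) U}"

lemma U_L2: "U \<in> L2 M"
  using U \<mu> by (rule has_law_P2_L2)

lemma optimal_cone_iff:
  "k \<in> optimal_cone \<longleftrightarrow> k \<in> L2 M \<and> (\<forall>V. has_law M V \<mu> \<longrightarrow> correlation M k V \<le> correlation M k U)"
  using U by (auto simp: optimal_cone_def is_arg_max_def not_less)

lemma optimal_cone_L2: "k \<in> optimal_cone \<Longrightarrow> k \<in> L2 M"
  by (simp add: optimal_cone_def)

lemma optimal_cone_add:
  assumes k: "k \<in> optimal_cone" and l: "l \<in> optimal_cone"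
  shows "(\<lambda>\<omega>. k \<omega> + l \<omega>) \<in> optimal_cone"
proof -
  have "correlation M (\<lambda>\<omega>. k \<omega> + l \<omega>) V \<le> correlation M (\<lambda>\<omega>. k \<omega> + l \<omega>) U" if V: "has_law M V \<mu>" for V
    using k l V has_law_P2_L2[OF V \<mu>] U_L2
    by (auto simp: optimal_cone_iff correlation_add_left intro: add_mono)
  then show ?thesis using k l by (auto simp: optimal_cone_iff L2_add)
qed

lemma optimal_cone_scaleR:
  assumes k: "k \<in> optimal_cone" and c: "0 \<le> c"
  shows "(\<lambda>\<omega>. c *\<^sub>R k \<omega>) \<in> optimal_cone"
  using k c by (auto simp: optimal_cone_iff L2_scaleR correlation_scaleR_left intro: mult_left_mono)

lemma optimal_cone_zero: "(\<lambda>_. 0) \<in> optimal_cone"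
  by (auto simp: optimal_cone_iff L2_zero correlation_def)

lemma rho_add_optimal:
  assumes "k \<in> optimal_cone" "l \<in> optimal_cone"
  shows "\<rho> (\<lambda>\<omega>. k \<omega> + l \<omega>) = \<rho> k + \<rho> l"
  using additive assms unfolding comonotonic_additive_def comonotonic_def optimal_cone_def by blast

lemma rho_zero: "\<rho> (\<lambda>_. 0) = 0"
  using rho_add_optimal[OF optimal_cone_zero optimal_cone_zero] by simp

lemma rho_same_law: "same_law M X Y \<Longrightarrow> X \<in> L2 M \<Longrightarrow> \<rho> X = \<rho> Y"
  using law same_law_L2 unfolding law_invariant_def by blast

lemma rho_continuous: "continuous_functional M \<rho>"
  by (rule convex_lsc_continuous[OF lsc convex])

lemma optimal_cone_dense_in_law:
  assumes X: "X \<in> L2 M" and e: "0 < e"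
  obtains Y k where "Y \<in> L2 M" "L2_dist M X Y < e" "k \<in> optimal_cone" "same_law M k Y"
proof -
  obtain Y where Y: "simple_function M Y" "Y \<in> L2 M" "L2_dist M X Y < e"
    using L2_simple_dense[OF X e] by blast
  obtain k where "k \<in> L2 M" "same_law M k Y" "is_arg_max (correlation M k) (\<lambda>V. has_law M V \<mu>) U"
    using optimal_coupling_simple[OF U \<mu> hyperplane Y(1)] by blast
  then show thesis using Y that unfolding optimal_cone_def by blast
qed

text \<open>A vector of the cone is comonotonic with itself, so doubling is exact there; law
  invariance and continuity carry it to every \<open>X\<close>.\<close>

lemma rho_double:
  assumes X: "X \<in> L2 M"
  shows "\<rho> (\<lambda>\<omega>. 2 *\<^sub>R X \<omega>) = 2 * \<rho> X"
proof -
  have X2: "(\<lambda>\<omega>. 2 *\<^sub>R X \<omega>) \<in> L2 M" by (intro L2_intros X)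
  have close: "\<bar>\<rho> (\<lambda>\<omega>. 2 *\<^sub>R X \<omega>) - 2 * \<rho> X\<bar> \<le> 3 * e" if e: "0 < e" for e
  proof -
    obtain d1 where d1: "0 < d1" "\<And>Y. Y \<in> L2 M \<Longrightarrow> L2_dist M X Y < d1 \<Longrightarrow> \<bar>\<rho> Y - \<rho> X\<bar> < e"
      using rho_continuous X e unfolding continuous_functional_def by blast
    obtain d2 where d2: "0 < d2" "\<And>Y. Y \<in> L2 M \<Longrightarrow> L2_dist M (\<lambda>\<omega>. 2 *\<^sub>R X \<omega>) Y < d2 \<Longrightarrow> \<bar>\<rho> Y - \<rho> (\<lambda>\<omega>. 2 *\<^sub>R X \<omega>)\<bar> < e"
      using rho_continuous X2 e unfolding continuous_functional_def by blast
    have "0 < min d1 (d2 / 2)" using d1 d2 by simp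
    then obtain Y k where Y: "Y \<in> L2 M" "L2_dist M X Y < min d1 (d2 / 2)"
      and k: "k \<in> optimal_cone" "same_law M k Y"
      by (rule optimal_cone_dense_in_law[OF X])
    have kL: "k \<in> L2 M" using k(1) by (rule optimal_cone_L2)
    have "\<rho> (\<lambda>\<omega>. 2 *\<^sub>R k \<omega>) = 2 * \<rho> k"
      using rho_add_optimal[OF k(1) k(1)] by (simp add: scaleR_2)
    moreover have "\<rho> k = \<rho> Y" by (rule rho_same_law[OF k(2) kL])
    moreover have "\<rho> (\<lambda>\<omega>. 2 *\<^sub>R k \<omega>) = \<rho> (\<lambda>\<omega>. 2 *\<^sub>R Y \<omega>)"
      by (intro rho_same_law same_law_compose[OF k(2), of "\<lambda>x. 2 *\<^sub>R x"] L2_scaleR kL) measurable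
    moreover have "L2_dist M (\<lambda>\<omega>. 2 *\<^sub>R X \<omega>) (\<lambda>\<omega>. 2 *\<^sub>R Y \<omega>) = 2 * L2_dist M X Y"
      using L2_norm_scaleR[of M 2 "\<lambda>\<omega>. X \<omega> - Y \<omega>"] by (simp add: L2_dist_def scaleR_diff_right)
    then have "\<bar>\<rho> (\<lambda>\<omega>. 2 *\<^sub>R Y \<omega>) - \<rho> (\<lambda>\<omega>. 2 *\<^sub>R X \<omega>)\<bar> < e"
      using Y by (intro d2(2) L2_scaleR) auto
    moreover have "\<bar>\<rho> Y - \<rho> X\<bar> < e" using Y by (intro d1(2)) auto
    ultimately show ?thesis by linarith
  qed
  have "\<bar>\<rho> (\<lambda>\<omega>. 2 *\<^sub>R X \<omega>) - 2 * \<rho> X\<bar> \<le> 0"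
  proof (rule field_le_epsilon)
    fix e :: real assume "0 < e"
    then show "\<bar>\<rho> (\<lambda>\<omega>. 2 *\<^sub>R X \<omega>) - 2 * \<rho> X\<bar> \<le> 0 + e" using close[of "e / 3"] by simp
  qed
  then show ?thesis by simp
qed

text \<open>Convexity at the midpoint of \<open>2 X\<close> and \<open>2 Y\<close>.\<close>

lemma rho_subadditive:
  assumes X: "X \<in> L2 M" and Y: "Y \<in> L2 M"
  shows "\<rho> (\<lambda>\<omega>. X \<omega> + Y \<omega>) \<le> \<rho> X + \<rho> Y"
proof -
  have "(\<lambda>\<omega>. (1/2) *\<^sub>R (2 *\<^sub>R X \<omega>) + (1 - 1/2) *\<^sub>R (2 *\<^sub>R Y \<omega>)) = (\<lambda>\<omega>. X \<omega> + Y \<omega>)" by simp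
  then have "\<rho> (\<lambda>\<omega>. X \<omega> + Y \<omega>) \<le> (1/2) * \<rho> (\<lambda>\<omega>. 2 *\<^sub>R X \<omega>) + (1 - 1/2) * \<rho> (\<lambda>\<omega>. 2 *\<^sub>R Y \<omega>)"
    using convex[unfolded convex_functional_def, rule_format, OF L2_scaleR[OF X] L2_scaleR[OF Y], of "1/2" 2 2] by simp
  then show ?thesis by (simp add: rho_double X Y)
qed

text \<open>Convexity between \<open>X\<close> and 0 gives one inequality for factors in the unit
  interval. Subadditivity for the factors \<open>s\<close> and \<open>1 - s\<close> turns it into an
  equality, and larger factors follow by inversion.\<close>

lemma rho_scaleR:
  assumes X: "X \<in> L2 M" and t: "0 < t"
  shows "\<rho> (\<lambda>\<omega>. t *\<^sub>R X \<omega>) = t * \<rho> X"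
proof -
  have le: "\<rho> (\<lambda>\<omega>. s *\<^sub>R Y \<omega>) \<le> s * \<rho> Y" if "Y \<in> L2 M" "0 \<le> s" "s \<le> 1" for Y s
    using convex[unfolded convex_functional_def, rule_format, OF that(1) L2_zero, of s] that by (simp add: rho_zero)
  have small: "\<rho> (\<lambda>\<omega>. s *\<^sub>R Y \<omega>) = s * \<rho> Y" if Y: "Y \<in> L2 M" and s: "0 \<le> s" "s \<le> 1" for Y s
  proof (rule antisym[OF le[OF that]])
    have "\<rho> Y \<le> \<rho> (\<lambda>\<omega>. s *\<^sub>R Y \<omega>) + \<rho> (\<lambda>\<omega>. (1 - s) *\<^sub>R Y \<omega>)"
      using rho_subadditive[OF L2_scaleR[OF Y, of s] L2_scaleR[OF Y, of "1 - s"]]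
      by (simp flip: scaleR_left_distrib)
    also have "\<rho> (\<lambda>\<omega>. (1 - s) *\<^sub>R Y \<omega>) \<le> (1 - s) * \<rho> Y" using s by (intro le Y) auto
    finally show "s * \<rho> Y \<le> \<rho> (\<lambda>\<omega>. s *\<^sub>R Y \<omega>)" by (simp add: algebra_simps)
  qed
  show ?thesis
  proof (cases "t \<le> 1")
    case True
    then show ?thesis using small[OF X, of t] t by simp
  next
    case False
    then have "\<rho> (\<lambda>\<omega>. (1/t) *\<^sub>R (t *\<^sub>R X \<omega>)) = (1/t) * \<rho> (\<lambda>\<omega>. t *\<^sub>R X \<omega>)"
      by (intro small L2_scaleR X) auto
    then show ?thesis using t by (simp add: field_simps)
  qed
qed

lemma rho_bounded:
  obtains C where "\<And>X. X \<in> L2 M \<Longrightarrow> \<rho> X \<le> C * L2_norm M X"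
proof -
  obtain r B where r: "0 < r" and B: "\<And>Y. Y \<in> L2 M \<Longrightarrow> L2_norm M Y < r \<Longrightarrow> \<rho> (\<lambda>\<omega>. 0 + Y \<omega>) \<le> B"
    using convex_lsc_locally_bounded[OF lsc convex L2_zero] by blast
  define C where "C = (\<bar>B\<bar> + 1) / r"
  have C: "0 < C" using r by (simp add: C_def add_nonneg_pos)
  have "\<rho> X \<le> C * L2_norm M X" if X: "X \<in> L2 M" for X
  proof -
    \<comment> \<open>Normalising by any \<open>s\<close> above the norm avoids a division by a norm
      that may vanish.\<close>
    have "\<rho> X / C \<le> s" if s: "L2_norm M X < s" for s
    proof -
      have s0: "0 < s" using s L2_dist_nonneg[of M X "\<lambda>_. 0"] by linarith
      have "L2_norm M (\<lambda>\<omega>. (r / s) *\<^sub>R X \<omega>) = r * L2_norm M X / s"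
        using r s0 by (simp add: L2_norm_scaleR)
      also have "\<dots> < r" using r s s0 by (simp add: divide_less_eq)
      finally have "\<rho> (\<lambda>\<omega>. (r / s) *\<^sub>R X \<omega>) \<le> B" using B[OF L2_scaleR[OF X]] by simp
      then have "(r / s) * \<rho> X \<le> \<bar>B\<bar> + 1" using rho_scaleR[OF X, of "r / s"] r s0 by simp
      then have "\<rho> X \<le> C * s" using r s0 by (simp add: C_def field_simps)
      then show ?thesis using C by (simp add: field_simps)
    qed
    then have "\<rho> X / C \<le> L2_norm M X" by (rule dense_ge)
    then show ?thesis using C by (simp add: field_simps)
  qed
  then show thesis by (rule that)
qed

text \<open>The subgradient is taken of \<open>q X = (INF k\<in>optimal_cone. \<rho> (X + k) - \<rho> k)\<close>, which is
  sublinear because \<open>\<rho>\<close> is additive on the cone. From \<open>q \<le> \<rho>\<close> it is one of \<open>\<rho>\<close>, and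
  \<open>q (- k) \<le> - \<rho> k\<close> makes it exact on the cone.\<close>

lemma rho_subgradient:
  obtains V where "V \<in> L2 M" "\<And>X. X \<in> L2 M \<Longrightarrow> correlation M X V \<le> \<rho> X"
    "\<And>k. k \<in> optimal_cone \<Longrightarrow> correlation M k V = \<rho> k"
proof -
  define g where "g X k = \<rho> (\<lambda>\<omega>. X \<omega> + k \<omega>) - \<rho> k" for X k
  define q where "q X = (INF k\<in>optimal_cone. g X k)" for X
  have ne: "optimal_cone \<noteq> {}" using optimal_cone_zero by blast
  have bdd: "bdd_below (g X ` optimal_cone)" if X: "X \<in> L2 M" for X
  proof (rule bdd_belowI2)
    fix k assume k: "k \<in> optimal_cone"
    have "\<rho> k \<le> \<rho> (\<lambda>\<omega>. X \<omega> + k \<omega>) + \<rho> (\<lambda>\<omega>. - X \<omega>)"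
      using rho_subadditive[OF L2_add[OF X optimal_cone_L2[OF k]] L2_uminus[OF X]] by simp
    then show "- \<rho> (\<lambda>\<omega>. - X \<omega>) \<le> g X k" by (simp add: g_def)
  qed
  have q_le: "q X \<le> g X k" if "X \<in> L2 M" "k \<in> optimal_cone" for X k
    unfolding q_def by (rule cINF_lower[OF bdd[OF that(1)] that(2)])
  have q_le_rho: "q X \<le> \<rho> X" if X: "X \<in> L2 M" for X
    using q_le[OF X optimal_cone_zero] by (simp add: g_def rho_zero)
  obtain C where C: "\<And>X. X \<in> L2 M \<Longrightarrow> \<rho> X \<le> C * L2_norm M X"
    using rho_bounded by blast
  have sub: "q (\<lambda>\<omega>. X \<omega> + Y \<omega>) \<le> q X + q Y" if X: "X \<in> L2 M" and Y: "Y \<in> L2 M" for X Y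
  proof -
    have le: "q (\<lambda>\<omega>. X \<omega> + Y \<omega>) \<le> g X k + g Y l" if k: "k \<in> optimal_cone" and l: "l \<in> optimal_cone" for k l
    proof -
      note kL = optimal_cone_L2[OF k] and lL = optimal_cone_L2[OF l]
      have "q (\<lambda>\<omega>. X \<omega> + Y \<omega>) \<le> g (\<lambda>\<omega>. X \<omega> + Y \<omega>) (\<lambda>\<omega>. k \<omega> + l \<omega>)"
        by (rule q_le[OF L2_add[OF X Y] optimal_cone_add[OF k l]])
      moreover have "\<rho> (\<lambda>\<omega>. X \<omega> + Y \<omega> + (k \<omega> + l \<omega>)) \<le> \<rho> (\<lambda>\<omega>. X \<omega> + k \<omega>) + \<rho> (\<lambda>\<omega>. Y \<omega> + l \<omega>)"
        using rho_subadditive[OF L2_add[OF X kL] L2_add[OF Y lL]] by (simp add: algebra_simps)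
      ultimately show ?thesis by (simp add: g_def rho_add_optimal[OF k l])
    qed
    \<comment> \<open>The two infima are taken one at a time, over \<open>k\<close> first and then
      over \<open>l\<close>.\<close>
    have "q (\<lambda>\<omega>. X \<omega> + Y \<omega>) - g Y l \<le> q X" if l: "l \<in> optimal_cone" for l
      unfolding q_def[of X] using le[OF _ l] by (intro cINF_greatest[OF ne]) (simp add: algebra_simps)
    then have "q (\<lambda>\<omega>. X \<omega> + Y \<omega>) - q X \<le> q Y"
      unfolding q_def[of Y] by (intro cINF_greatest[OF ne]) (simp add: algebra_simps)
    then show ?thesis by simp
  qed
  have hom: "q (\<lambda>\<omega>. t *\<^sub>R X \<omega>) \<le> t * q X" if t: "0 < t" and X: "X \<in> L2 M" for t X
  proof -
    have "q (\<lambda>\<omega>. t *\<^sub>R X \<omega>) / t \<le> g X k" if k: "k \<in> optimal_cone" for k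
    proof -
      have "q (\<lambda>\<omega>. t *\<^sub>R X \<omega>) \<le> g (\<lambda>\<omega>. t *\<^sub>R X \<omega>) (\<lambda>\<omega>. t *\<^sub>R k \<omega>)"
        using t by (intro q_le L2_scaleR X optimal_cone_scaleR k) auto
      also have "\<dots> = t * g X k"
        using rho_scaleR[OF L2_add[OF X optimal_cone_L2[OF k]] t] rho_scaleR[OF optimal_cone_L2[OF k] t]
        by (simp add: g_def scaleR_right_distrib right_diff_distrib)
      finally show ?thesis using t by (simp add: field_simps)
    qed
    then have "q (\<lambda>\<omega>. t *\<^sub>R X \<omega>) / t \<le> q X"
      unfolding q_def[of X] by (intro cINF_greatest[OF ne])
    then show ?thesis using t by (simp add: field_simps)
  qed
  have zero: "0 \<le> q (\<lambda>_. 0)"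
    unfolding q_def by (intro cINF_greatest[OF ne]) (simp add: g_def)
  obtain V where V: "V \<in> L2 M" "\<And>X. X \<in> L2 M \<Longrightarrow> correlation M X V \<le> q X"
  proof (rule sublinear_subgradient[of q C])
    show "q X \<le> C * L2_norm M X" if "X \<in> L2 M" for X
      using q_le_rho[OF that] C[OF that] by (rule order_trans)
  qed (use sub hom zero in auto)
  have 1: "correlation M X V \<le> \<rho> X" if "X \<in> L2 M" for X
    using V(2)[OF that] q_le_rho[OF that] by simp
  moreover have "correlation M k V = \<rho> k" if k: "k \<in> optimal_cone" for k
  proof (rule antisym)
    note kL = optimal_cone_L2[OF k]
    show "correlation M k V \<le> \<rho> k" by (rule 1[OF kL])
    have "correlation M (\<lambda>\<omega>. - k \<omega>) V \<le> g (\<lambda>\<omega>. - k \<omega>) k"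
      using V(2)[OF L2_uminus[OF kL]] q_le[OF L2_uminus[OF kL] k] by simp
    then show "\<rho> k \<le> correlation M k V"
      by (simp add: g_def rho_zero correlation_uminus_left)
  qed
  ultimately show thesis using V(1) that by blast
qed

text \<open>Approximate \<open>X\<close> by a \<open>Y\<close> that has the law of some
  \<open>k\<close> in the cone. There \<open>\<rho>\<close> is the correlation of \<open>k\<close>
  with \<open>V\<close>, and rearranging \<open>V\<close> moves this correlation from
  \<open>k\<close> to \<open>Y\<close>. The three errors are \<open>e / 3\<close> each.\<close>

lemma rho_lower_approx:
  assumes V: "V \<in> L2 M" and exact: "\<And>k. k \<in> optimal_cone \<Longrightarrow> correlation M k V = \<rho> k"
    and X: "X \<in> L2 M" and e: "0 < e"
  obtains V' where "same_law M V' V" "\<rho> X - e \<le> correlation M X V'"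
proof -
  obtain d where d: "0 < d" "\<And>Y. Y \<in> L2 M \<Longrightarrow> L2_dist M X Y < d \<Longrightarrow> \<rho> X - e / 3 < \<rho> Y"
    using lsc[unfolded lsc_functional_def, rule_format, OF X, of "e / 3"] e by auto
  \<comment> \<open>The second bound controls the correlation of \<open>X - Y\<close> with
    \<open>V'\<close>, whose norm is that of \<open>V\<close>.\<close>
  define d' where "d' = min d (e / (3 * (L2_norm M V + 1)))"
  have pos: "0 < L2_norm M V + 1" by (simp add: add_nonneg_pos)
  have "0 < d'" using d e pos by (simp add: d'_def)
  then obtain Y k where Y: "Y \<in> L2 M" "L2_dist M X Y < d'" and k: "k \<in> optimal_cone" "same_law M k Y"
    by (rule optimal_cone_dense_in_law[OF X])
  have kL: "k \<in> L2 M" using k(1) by (rule optimal_cone_L2)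
  obtain V' where V': "same_law M V' V" "\<bar>correlation M Y V' - correlation M k V\<bar> \<le> e / 3"
    by (rule correlation_transfer[OF nonatomic kL V same_law_sym[OF k(2)], of "e / 3"]) (use e in auto)
  have V'L: "V' \<in> L2 M" using V same_law_L2[OF same_law_sym[OF V'(1)]] by simp
  have "L2_norm M V' = L2_norm M V"
    using same_law_integral(1)[OF V'(1), of "\<lambda>x. (norm x)\<^sup>2"] by (simp add: L2_dist_def)
  then have "\<bar>correlation M (\<lambda>\<omega>. X \<omega> - Y \<omega>) V'\<bar> \<le> L2_dist M X Y * L2_norm M V"
    using correlation_Cauchy_Schwarz[OF L2_diff[OF X Y(1)] V'L] by (simp add: L2_dist_def)
  also have "\<dots> \<le> e / (3 * (L2_norm M V + 1)) * (L2_norm M V + 1)"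
    using Y(2) e pos by (intro mult_mono) (auto simp: d'_def)
  also have "\<dots> = e / 3"
  proof -
    have "e / (3 * a) * a = e / 3" if "0 < a" for a :: real using that by simp
    then show ?thesis using pos by blast
  qed
  finally have "\<bar>correlation M X V' - correlation M Y V'\<bar> \<le> e / 3"
    by (simp add: correlation_diff_left X Y V'L)
  moreover have "\<rho> X - e / 3 < \<rho> Y" using Y by (intro d(2)) (auto simp: d'_def)
  moreover have "\<rho> Y = correlation M k V"
    using rho_same_law[OF k(2) kL] exact[OF k(1)] by simp
  ultimately have "\<rho> X - e \<le> correlation M X V'" using V'(2) by argo
  with V'(1) show thesis by (rule that)
qed

text \<open>A coupling of \<open>X\<close> with \<open>V'\<close> is nearly a coupling of a
  rearranged \<open>X\<close> with \<open>V\<close> itself, to which \<open>dom\<close> and law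
  invariance apply.\<close>

lemma rho_upper_same_law:
  assumes V: "V \<in> L2 M" and dom: "\<And>X. X \<in> L2 M \<Longrightarrow> correlation M X V \<le> \<rho> X"
    and V': "same_law M V' V" and X: "X \<in> L2 M"
  shows "correlation M X V' \<le> \<rho> X"
proof (rule field_le_epsilon)
  fix e :: real assume e: "0 < e"
  have V'L: "V' \<in> L2 M" using V same_law_L2[OF same_law_sym[OF V']] by simp
  obtain Y where Y: "same_law M Y X" "\<bar>correlation M V Y - correlation M V' X\<bar> \<le> e"
    by (rule correlation_transfer[OF nonatomic V'L X same_law_sym[OF V'] e])
  have YL: "Y \<in> L2 M" using X same_law_L2[OF same_law_sym[OF Y(1)]] by simp
  have "correlation M Y V \<le> \<rho> X" using dom[OF YL] rho_same_law[OF Y(1) YL] by simp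
  then show "correlation M X V' \<le> \<rho> X + e"
    using Y(2) correlation_commute[of M V Y] correlation_commute[of M V' X] by linarith
qed

lemma rho_eq_max_correlation:
  assumes V: "V \<in> L2 M" and dom: "\<And>X. X \<in> L2 M \<Longrightarrow> correlation M X V \<le> \<rho> X"
    and exact: "\<And>k. k \<in> optimal_cone \<Longrightarrow> correlation M k V = \<rho> k" and X: "X \<in> L2 M"
  shows "ereal (\<rho> X) = max_correlation M (distr M borel V) X"
proof (rule antisym)
  have Vm: "V \<in> borel_measurable M" using V by (rule L2_borel)
  show "max_correlation M (distr M borel V) X \<le> ereal (\<rho> X)"
    unfolding max_correlation_def
  proof (rule Sup_least)
    fix z assume "z \<in> {ereal (correlation M X W) |W. has_law M W (distr M borel V)}"
    then obtain W where W: "z = ereal (correlation M X W)" "has_law M W (distr M borel V)" by blast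
    then have "same_law M W V" using Vm by (simp add: has_law_def same_law_def)
    from rho_upper_same_law[OF V dom this X] show "z \<le> ereal (\<rho> X)" using W(1) by simp
  qed
  show "ereal (\<rho> X) \<le> max_correlation M (distr M borel V) X"
  proof (rule ereal_le_epsilon2)
    fix e :: real assume e: "0 < e"
    obtain W where W: "same_law M W V" "\<rho> X - e \<le> correlation M X W"
      using rho_lower_approx[OF V exact X e] by blast
    then have "has_law M W (distr M borel V)" by (simp add: has_law_def same_law_def)
    then have "ereal (correlation M X W) \<le> max_correlation M (distr M borel V) X"
      unfolding max_correlation_def by (intro Sup_upper) blast
    moreover have "ereal (\<rho> X) \<le> ereal (correlation M X W) + ereal e" using W(2) by simp
    ultimately show "ereal (\<rho> X) \<le> max_correlation M (distr M borel V) X + ereal e"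
      using add_right_mono order_trans by blast
  qed
qed

text \<open>Moves the rearrangement from \<open>V\<close> to \<open>X\<close>, so that several
  vectors can be aligned with one and the same \<open>V\<close>.\<close>

lemma rho_lower_approx_same_law:
  assumes V: "V \<in> L2 M" and exact: "\<And>k. k \<in> optimal_cone \<Longrightarrow> correlation M k V = \<rho> k"
    and X: "X \<in> L2 M" and e: "0 < e"
  obtains X' where "same_law M X' X" "\<rho> X - e \<le> correlation M X' V"
proof -
  obtain W where W: "same_law M W V" "\<rho> X - e / 2 \<le> correlation M X W"
    by (rule rho_lower_approx[OF V exact X, of "e / 2"]) (use e in auto)
  have WL: "W \<in> L2 M" using V same_law_L2[OF same_law_sym[OF W(1)]] by simp
  obtain Y where Y: "same_law M Y X" "\<bar>correlation M V Y - correlation M W X\<bar> \<le> e / 2"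
    by (rule correlation_transfer[OF nonatomic WL X same_law_sym[OF W(1)], of "e / 2"]) (use e in auto)
  then have "\<rho> X - e \<le> correlation M Y V"
    using W(2) correlation_commute[of M V Y] correlation_commute[of M W X] by linarith
  with Y(1) show thesis by (rule that)
qed

text \<open>One inequality is subadditivity with law invariance. For the other, both vectors are
  nearly optimally rearranged against the same \<open>V\<close>, and \<open>dom\<close> is applied
  to their sum.\<close>

lemma rho_strongly_coherent:
  assumes V: "V \<in> L2 M" and dom: "\<And>X. X \<in> L2 M \<Longrightarrow> correlation M X V \<le> \<rho> X"
    and exact: "\<And>k. k \<in> optimal_cone \<Longrightarrow> correlation M k V = \<rho> k"
  shows "strongly_coherent M \<rho>"
proof -
  have "ereal (\<rho> X + \<rho> Y) = Sup {ereal (\<rho> (\<lambda>\<omega>. X' \<omega> + Y' \<omega>)) | X' Y'. same_law M X' X \<and> same_law M Y' Y}"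
    (is "_ = Sup ?S") if X: "X \<in> L2 M" and Y: "Y \<in> L2 M" for X Y
  proof (rule antisym)
    show "Sup ?S \<le> ereal (\<rho> X + \<rho> Y)"
    proof (rule Sup_least)
      fix z assume "z \<in> ?S"
      then obtain X' Y' where z: "z = ereal (\<rho> (\<lambda>\<omega>. X' \<omega> + Y' \<omega>))" "same_law M X' X" "same_law M Y' Y" by blast
      have L: "X' \<in> L2 M" "Y' \<in> L2 M"
        using X Y same_law_L2[OF same_law_sym[OF z(2)]] same_law_L2[OF same_law_sym[OF z(3)]] by auto
      show "z \<le> ereal (\<rho> X + \<rho> Y)"
        using rho_subadditive[OF L] rho_same_law[OF z(2) L(1)] rho_same_law[OF z(3) L(2)] z(1) by simp
    qed
    show "ereal (\<rho> X + \<rho> Y) \<le> Sup ?S"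
    proof (rule ereal_le_epsilon2)
      fix e :: real assume e: "0 < e"
      obtain X' where X': "same_law M X' X" "\<rho> X - e / 2 \<le> correlation M X' V" 
        by (rule rho_lower_approx_same_law[OF V exact X, of "e / 2"]) (use e in auto)
      obtain Y' where Y': "same_law M Y' Y" "\<rho> Y - e / 2 \<le> correlation M Y' V" 
        by (rule rho_lower_approx_same_law[OF V exact Y, of "e / 2"]) (use e in auto)
      have L: "X' \<in> L2 M" "Y' \<in> L2 M"
        using X Y same_law_L2[OF same_law_sym[OF X'(1)]] same_law_L2[OF same_law_sym[OF Y'(1)]] by auto
      have "correlation M (\<lambda>\<omega>. X' \<omega> + Y' \<omega>) V \<le> \<rho> (\<lambda>\<omega>. X' \<omega> + Y' \<omega>)" by (intro dom L2_add L)
      then have "\<rho> X + \<rho> Y \<le> \<rho> (\<lambda>\<omega>. X' \<omega> + Y' \<omega>) + e"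
        using X'(2) Y'(2) by (simp add: correlation_add_left L V)
      then have "ereal (\<rho> X + \<rho> Y) \<le> ereal (\<rho> (\<lambda>\<omega>. X' \<omega> + Y' \<omega>)) + ereal e" by simp
      moreover have "ereal (\<rho> (\<lambda>\<omega>. X' \<omega> + Y' \<omega>)) \<le> Sup ?S" using X'(1) Y'(1) by (intro Sup_upper) blast
      ultimately show "ereal (\<rho> X + \<rho> Y) \<le> Sup ?S + ereal e"
        using add_right_mono order_trans by blast
    qed
  qed
  then show ?thesis using convex rho_continuous by (auto simp: strongly_coherent_def)
qed

end

section \<open>Location-scale baselines\<close>

text \<open>If \<open>b\<close> had a component \<open>w\<close> orthogonal to \<open>a\<close>, the
  direction \<open>- w\<close>, tilted slightly towards \<open>a\<close>, would violate
  \<open>half\<close>.\<close>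

lemma nonneg_multiple_if_halfspace_subset:
  fixes a b :: "'b::real_inner"
  assumes half: "\<And>e. 0 < e \<bullet> a \<Longrightarrow> 0 \<le> e \<bullet> b" and a: "a \<noteq> 0"
  shows "\<exists>c\<ge>0. b = c *\<^sub>R a"
proof -
  define c where "c = (a \<bullet> b) / (a \<bullet> a)"
  define w where "w = b - c *\<^sub>R a"
  have aa: "0 < a \<bullet> a" using a by simp
  have wa: "w \<bullet> a = 0" 
  proof -
    have "c * (a \<bullet> a) = a \<bullet> b" using aa by (simp add: c_def)
    then show ?thesis by (simp add: w_def inner_diff_left inner_commute[of b a])
  qed
  have wb: "w \<bullet> b = w \<bullet> w" using wa by (simp add: w_def inner_diff_right)
  have "w = 0"
  proof (rule ccontr)
    assume "w \<noteq> 0"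
    then have ww: "0 < w \<bullet> w" by simp
    \<comment> \<open>A tilt so small that \<open>t * (a \<bullet> b)\<close> stays below
      \<open>w \<bullet> w\<close>.\<close>
    define t where "t = (w \<bullet> w) / (2 * (\<bar>a \<bullet> b\<bar> + 1))"
    have pos: "0 < 2 * (\<bar>a \<bullet> b\<bar> + 1)" by (simp add: add_nonneg_pos)
    have t: "0 < t" using ww pos unfolding t_def by (rule divide_pos_pos)
    have "0 < (t *\<^sub>R a - w) \<bullet> a" using t aa wa by (simp add: inner_diff_left)
    then have "0 \<le> (t *\<^sub>R a - w) \<bullet> b" by (rule half)
    then have "w \<bullet> w \<le> t * (a \<bullet> b)" by (simp add: inner_diff_left wb)
    also have "\<dots> \<le> t * \<bar>a \<bullet> b\<bar>" using t by (intro mult_left_mono) auto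
    also have "\<dots> < t * (2 * (\<bar>a \<bullet> b\<bar> + 1))" using t by (intro mult_strict_left_mono) auto
    also have "\<dots> = w \<bullet> w" using pos by (simp add: t_def)
    finally show False by simp
  qed
  moreover have "0 \<le> c" using half[OF aa] aa by (simp add: c_def)
  ultimately show ?thesis by (auto simp: w_def)
qed

context comonotonic_risk_measure
begin

text \<open>The vector is a subgradient at \<open>U\<close> of the convex potential
  \<open>max (e \<bullet> v - c) 0\<close>.\<close>

lemma halfspace_indicator_optimal:
  "(\<lambda>\<omega>. indicator {\<omega> \<in> space M. c < e \<bullet> U \<omega>} \<omega> *\<^sub>R e) \<in> optimal_cone"
proof -
  have Um[measurable]: "U \<in> borel_measurable M" using U_L2 by (rule L2_borel)
  let ?k = "\<lambda>\<omega>. indicator {\<omega> \<in> space M. c < e \<bullet> U \<omega>} \<omega> *\<^sub>R e"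
  let ?\<phi> = "\<lambda>v. max (e \<bullet> v - c) 0"
  have k: "?k \<in> L2 M"
    by (rule L2_bounded[of _ "norm e"]) (auto simp: indicator_def)
  moreover have "is_arg_max (correlation M ?k) (\<lambda>V. has_law M V \<mu>) U"
  proof (rule optimal_couplingI[OF U \<mu> k, of ?\<phi>])
    have "integrable M (\<lambda>\<omega>. e \<bullet> U \<omega>)"
      using L2_integrable[OF U_L2] by simp
    then show "integrable M (\<lambda>\<omega>. max (e \<bullet> U \<omega> - c) 0)" by simp
    fix \<omega> v assume "\<omega> \<in> space M"
    then show "?k \<omega> \<bullet> v - ?\<phi> v \<le> ?k \<omega> \<bullet> U \<omega> - ?\<phi> (U \<omega>)"
      by (auto simp: indicator_def max_def)
  qed measurable
  ultimately show ?thesis by (simp add: optimal_cone_def)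
qed

text \<open>Otherwise exchanging parts of equal probability across the boundary of the half-space would
  increase the correlation with \<open>V\<close>, but not \<open>\<rho>\<close>.\<close>

lemma halfspace_upper_level_set:
  assumes V: "V \<in> L2 M" and dom: "\<And>X. X \<in> L2 M \<Longrightarrow> correlation M X V \<le> \<rho> X"
    and exact: "\<And>k. k \<in> optimal_cone \<Longrightarrow> correlation M k V = \<rho> k"
  shows "(AE \<omega> in M. \<not> (c < e \<bullet> U \<omega> \<and> e \<bullet> V \<omega> < t)) \<or> (AE \<omega> in M. \<not> (e \<bullet> U \<omega> \<le> c \<and> t < e \<bullet> V \<omega>))"
proof (rule ccontr)
  have Um[measurable]: "U \<in> borel_measurable M" using U_L2 by (rule L2_borel)
  have Vm[measurable]: "V \<in> borel_measurable M" using V by (rule L2_borel)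
  define A where "A = {\<omega> \<in> space M. c < e \<bullet> U \<omega>}"
  define A0 where "A0 = {\<omega> \<in> space M. c < e \<bullet> U \<omega> \<and> e \<bullet> V \<omega> < t}"
  define B0 where "B0 = {\<omega> \<in> space M. e \<bullet> U \<omega> \<le> c \<and> t < e \<bullet> V \<omega>}"
  have [measurable]: "A \<in> events" "A0 \<in> events" "B0 \<in> events"
    unfolding A_def A0_def B0_def by measurable
  assume "\<not> ?thesis"
  then have neg: "\<not> (AE \<omega> in M. \<omega> \<notin> A0)" "\<not> (AE \<omega> in M. \<omega> \<notin> B0)"
    unfolding A0_def B0_def by (auto simp: AE_conj_iff cong: AE_cong)
  have pos: "0 < prob A0" "0 < prob B0"
    using neg prob_eq_0[of A0] prob_eq_0[of B0] by (auto simp: zero_less_measure_iff)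
  define s where "s = min (prob A0) (prob B0)"
  have s: "0 < s" "s \<le> prob A0" "s \<le> prob B0" using pos by (auto simp: s_def)
  obtain A1 where A1[measurable]: "A1 \<in> events" and A1s: "A1 \<subseteq> A0" "prob A1 = s"
    by (rule nonatomic_intermediate_event[OF nonatomic, of A0 s]) (use s in auto)
  obtain B1 where B1[measurable]: "B1 \<in> events" and B1s: "B1 \<subseteq> B0" "prob B1 = s"
    by (rule nonatomic_intermediate_event[OF nonatomic, of B0 s]) (use s in auto)
  have sub: "A1 \<subseteq> A" "B1 \<inter> A = {}" using A1s B1s by (auto simp: A_def A0_def B0_def)
  define B where "B = (A - A1) \<union> B1"
  have [measurable]: "B \<in> events" unfolding B_def by measurable
  have "prob B = prob (A - A1) + prob B1"
    unfolding B_def using sub by (intro finite_measure_Union) auto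
  also have "prob (A - A1) = prob A - prob A1" using sub by (intro finite_measure_Diff) auto
  finally have probB: "prob B = prob A" using A1s B1s by simp
  have law01: "same_law M (indicator A) (indicator B :: 'a \<Rightarrow> real)"
  proof (rule same_law_discreteI[of _ _ "{0, 1}"])
    have 1: "indicator C -` {1::real} \<inter> space M = C" "indicator C -` {0::real} \<inter> space M = space M - C"
      if "C \<in> events" for C
      using sets.sets_into_space[OF that] by (auto simp: indicator_def)
    show "prob (indicator A -` {x} \<inter> space M) = prob (indicator B -` {x} \<inter> space M)" if "x \<in> {0, 1::real}" for x
      using that by (auto simp: 1 prob_compl probB)
    show "(\<Sum>x\<in>{0, 1::real}. prob (indicator A -` {x} \<inter> space M)) = 1"
      by (simp add: 1 prob_compl)
  qed auto
  let ?k = "\<lambda>\<omega>. indicator A \<omega> *\<^sub>R e" and ?l = "\<lambda>\<omega>. indicator B \<omega> *\<^sub>R e"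
  have kl: "same_law M ?k ?l" by (rule same_law_compose[OF law01]) measurable
  have kopt: "?k \<in> optimal_cone" unfolding A_def by (rule halfspace_indicator_optimal)
  then have kL: "?k \<in> L2 M" by (rule optimal_cone_L2)
  have lL: "?l \<in> L2 M" by (rule same_law_L2[OF kl kL])
  have le: "correlation M ?l V \<le> correlation M ?k V"
    using dom[OF lL] exact[OF kopt] rho_same_law[OF kl kL] by simp
  \<comment> \<open>The pointwise gain of the exchange, measured from the level \<open>t\<close>.
    Since \<open>A1\<close> and \<open>B1\<close> have equal probability, the level drops out of the
    expectation, which is therefore at most 0 by \<open>le\<close>.\<close>
  define f where "f \<omega> = indicator B1 \<omega> * (e \<bullet> V \<omega> - t) + indicator A1 \<omega> * (t - e \<bullet> V \<omega>)" for \<omega>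
  have f_nonneg: "0 \<le> f \<omega>" for \<omega>
    using A1s(1) B1s(1) by (auto simp: f_def A0_def B0_def indicator_def)
  have f_eq: "f \<omega> = (?l \<omega> \<bullet> V \<omega> - ?k \<omega> \<bullet> V \<omega>) - t * (indicator B1 \<omega> - indicator A1 \<omega>)" for \<omega>
    using sub by (auto simp: f_def B_def indicator_def algebra_simps)
  have i: "integrable M (\<lambda>\<omega>. ?l \<omega> \<bullet> V \<omega>)" "integrable M (\<lambda>\<omega>. ?k \<omega> \<bullet> V \<omega>)"
    by (rule L2_integrable_inner[OF lL V], rule L2_integrable_inner[OF kL V])
  have j: "integrable M (indicator B1 :: 'a \<Rightarrow> real)" "integrable M (indicator A1 :: 'a \<Rightarrow> real)"
    by (auto simp: integrable_indicator_iff emeasure_eq_measure)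
  have fi: "integrable M f" unfolding f_eq[abs_def] using i j by auto
  have "expectation f = (correlation M ?l V - correlation M ?k V) - t * (prob B1 - prob A1)"
    unfolding f_eq[abs_def] correlation_def using i j by (simp add: measure_def)
  then have "expectation f \<le> 0" using le A1s B1s by simp
  moreover have "0 \<le> expectation f" by (rule Bochner_Integration.integral_nonneg) (rule f_nonneg)
  ultimately have "AE \<omega> in M. f \<omega> = 0"
    using integral_nonneg_eq_0_iff_AE[OF fi] f_nonneg by simp
  then have "AE \<omega> in M. \<omega> \<notin> B1"
  proof eventually_elim
    fix \<omega> assume f0: "f \<omega> = 0"
    show "\<omega> \<notin> B1"
    proof
      assume w: "\<omega> \<in> B1"
      then have "\<omega> \<notin> A1" using sub by blast
      moreover have "t < e \<bullet> V \<omega>" using w B1s(1) by (auto simp: B0_def)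
      ultimately show False using w f0 by (simp add: f_def)
    qed
  qed
  then have "prob B1 = 0" using prob_eq_0[of B1] by simp
  then show False using s B1s by simp
qed

text \<open>Directions from a countable dense set and rational levels leave a single exceptional
  null set. The strict inequalities at issue persist for nearby directions, so every
  \<open>e\<close> is covered.\<close>

lemma AE_monotone_coupling:
  assumes V: "V \<in> L2 M" and dom: "\<And>X. X \<in> L2 M \<Longrightarrow> correlation M X V \<le> \<rho> X"
    and exact: "\<And>k. k \<in> optimal_cone \<Longrightarrow> correlation M k V = \<rho> k"
  obtains G where "AE \<omega> in M. \<omega> \<in> G"
    "\<And>e \<omega> \<omega>'. \<omega> \<in> G \<Longrightarrow> \<omega>' \<in> G \<Longrightarrow> 0 < e \<bullet> (U \<omega> - U \<omega>') \<Longrightarrow> 0 \<le> e \<bullet> (V \<omega> - V \<omega>')"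
proof -
  obtain D :: "'b set" where D: "countable D" "\<And>S. open S \<Longrightarrow> S \<noteq> {} \<Longrightarrow> \<exists>d\<in>D. d \<in> S"
    using countable_dense_setE by blast
  define T where "T = D \<times> (\<rat> :: real set) \<times> (\<rat> :: real set)"
  have T: "countable T" unfolding T_def using D(1) by (intro countable_SIGMA countable_rat)
  let ?P = "\<lambda>(e, c, t) \<omega>. c < e \<bullet> U \<omega> \<and> e \<bullet> V \<omega> < t"
  let ?R = "\<lambda>(e, c, t) \<omega>. e \<bullet> U \<omega> \<le> c \<and> t < e \<bullet> V \<omega>"
  have ex: "\<exists>b. AE \<omega> in M. if b then \<not> ?P p \<omega> else \<not> ?R p \<omega>" for p
  proof -
    obtain e c t where p: "p = (e, c, t)" by (cases p) auto
    have "(AE \<omega> in M. \<not> ?P p \<omega>) \<or> (AE \<omega> in M. \<not> ?R p \<omega>)"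
      unfolding p prod.case by (rule halfspace_upper_level_set[OF V dom exact])
    then show ?thesis
    proof
      assume "AE \<omega> in M. \<not> ?P p \<omega>"
      then show ?thesis by (intro exI[of _ True]) simp
    next
      assume "AE \<omega> in M. \<not> ?R p \<omega>"
      then show ?thesis by (intro exI[of _ False]) simp
    qed
  qed
  obtain b where b: "\<forall>p. AE \<omega> in M. if b p then \<not> ?P p \<omega> else \<not> ?R p \<omega>"
    using choice[OF allI[OF ex]] ..
  define G where "G = {\<omega>. \<forall>p\<in>T. if b p then \<not> ?P p \<omega> else \<not> ?R p \<omega>}"
  have AE: "AE \<omega> in M. \<omega> \<in> G"
    unfolding G_def mem_Collect_eq using b by (subst AE_ball_countable[OF T]) blast
  have mono: "e \<bullet> V \<omega>' \<le> e \<bullet> V \<omega>"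
    if G: "\<omega> \<in> G" "\<omega>' \<in> G" and e: "e \<in> D" and less: "e \<bullet> U \<omega>' < e \<bullet> U \<omega>" for e \<omega> \<omega>'
  proof (rule ccontr)
    assume "\<not> e \<bullet> V \<omega>' \<le> e \<bullet> V \<omega>"
    then obtain t where t: "t \<in> \<rat>" "e \<bullet> V \<omega> < t" "t < e \<bullet> V \<omega>'"
      using Rats_dense_in_real[of "e \<bullet> V \<omega>" "e \<bullet> V \<omega>'"] by auto
    obtain c where c: "c \<in> \<rat>" "e \<bullet> U \<omega>' < c" "c < e \<bullet> U \<omega>"
      using Rats_dense_in_real[OF less] by auto
    have "(e, c, t) \<in> T" using e c t by (simp add: T_def)
    \<comment> \<open>Whichever alternative \<open>b\<close> selects, one of the two points
      contradicts it: \<open>\<omega>\<close> the first, \<open>\<omega>'\<close> the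
      second.\<close>
    then have "if b (e, c, t) then \<not> ?P (e, c, t) \<omega> else \<not> ?R (e, c, t) \<omega>'"
      using G unfolding G_def by (auto split: if_splits)
    then show False using c t by (simp split: if_splits)
  qed
  have "0 \<le> e \<bullet> (V \<omega> - V \<omega>')"
    if G: "\<omega> \<in> G" "\<omega>' \<in> G" and e: "0 < e \<bullet> (U \<omega> - U \<omega>')" for e \<omega> \<omega>'
  proof (rule ccontr)
    assume "\<not> 0 \<le> e \<bullet> (V \<omega> - V \<omega>')"
    then have "e \<in> {e. 0 < e \<bullet> (U \<omega> - U \<omega>')} \<inter> {e. e \<bullet> (V \<omega> - V \<omega>') < 0}" using e by simp
    moreover have "open ({e. 0 < e \<bullet> (U \<omega> - U \<omega>')} \<inter> {e. e \<bullet> (V \<omega> - V \<omega>') < 0})"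
      by (intro open_Int open_Collect_less continuous_intros)
    ultimately obtain d where d: "d \<in> D" "0 < d \<bullet> (U \<omega> - U \<omega>')" "d \<bullet> (V \<omega> - V \<omega>') < 0"
      using D(2) by blast
    then show False using mono[OF G d(1)] by (simp add: inner_diff_right)
  qed
  with AE show thesis by (rule that)
qed

text \<open>For \<open>U\<close>-images off the line through two base points, the three pairwise proportionality
  factors agree.\<close>

lemma AE_location_scale:
  assumes V: "V \<in> L2 M" and dom: "\<And>X. X \<in> L2 M \<Longrightarrow> correlation M X V \<le> \<rho> X"
    and exact: "\<And>k. k \<in> optimal_cone \<Longrightarrow> correlation M k V = \<rho> k"
    and dim: "2 \<le> DIM('b)"
  obtains c u0 where "0 \<le> c" "AE \<omega> in M. V \<omega> = c *\<^sub>R U \<omega> + u0"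
proof -
  have Um[measurable]: "U \<in> borel_measurable M" using U_L2 by (rule L2_borel)
  obtain G where G: "AE \<omega> in M. \<omega> \<in> G"
    and half: "\<And>e \<omega> \<omega>'. \<omega> \<in> G \<Longrightarrow> \<omega>' \<in> G \<Longrightarrow> 0 < e \<bullet> (U \<omega> - U \<omega>') \<Longrightarrow> 0 \<le> e \<bullet> (V \<omega> - V \<omega>')"
    using AE_monotone_coupling[OF V dom exact] by blast
  have par: "\<exists>c\<ge>0. V \<omega> - V \<omega>' = c *\<^sub>R (U \<omega> - U \<omega>')" if "\<omega> \<in> G" "\<omega>' \<in> G" "U \<omega> \<noteq> U \<omega>'" for \<omega> \<omega>'
    using half[OF that(1,2)] that(3) by (intro nonneg_multiple_if_halfspace_subset) auto
  have off: "AE \<omega> in M. a \<bullet> U \<omega> \<noteq> b" if "a \<noteq> 0" for a b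
  proof -
    have *: "AE u in \<mu>. a \<bullet> u \<noteq> b" by (rule AE_I'[OF hyperplane[OF that, of b]]) auto
    have lawU: "distr M borel U = \<mu>" using U by (simp add: has_law_def)
    have "AE u in distr M borel U. a \<bullet> u \<noteq> b" unfolding lawU by (rule *)
    then show ?thesis by (rule AE_distrD[OF Um])
  qed
  obtain \<omega>0 where w0: "\<omega>0 \<in> G" using eventually_happens'[OF ae_filter_bot G] by blast
  obtain a :: 'b where "a \<in> Basis" using nonempty_Basis by blast
  then have "a \<noteq> 0" by (rule nonzero_Basis)
  then have "AE \<omega> in M. \<omega> \<in> G \<and> a \<bullet> U \<omega> \<noteq> a \<bullet> U \<omega>0" using G off by auto
  then obtain \<omega>1 where w1: "\<omega>1 \<in> G" "a \<bullet> U \<omega>1 \<noteq> a \<bullet> U \<omega>0"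
    using eventually_happens'[OF ae_filter_bot] by blast
  then have ne: "U \<omega>1 \<noteq> U \<omega>0" by auto
  obtain c where c: "0 \<le> c" "V \<omega>1 - V \<omega>0 = c *\<^sub>R (U \<omega>1 - U \<omega>0)" using par[OF w1(1) w0 ne] by blast
  \<comment> \<open>The dimension enters here: a hyperplane with normal \<open>n\<close> contains
    both base points, and almost every \<open>U \<omega>\<close> lies off it.\<close>
  obtain n where n: "n \<noteq> 0" "n \<bullet> (U \<omega>1 - U \<omega>0) = 0"
    using orthogonal_to_vector_exists[OF dim, of "U \<omega>1 - U \<omega>0"] by (auto simp: orthogonal_def inner_commute)
  have "AE \<omega> in M. \<omega> \<in> G \<and> n \<bullet> U \<omega> \<noteq> n \<bullet> U \<omega>0" using G off[OF n(1)] by auto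
  then have "AE \<omega> in M. V \<omega> = c *\<^sub>R U \<omega> + (V \<omega>0 - c *\<^sub>R U \<omega>0)"
  proof eventually_elim
    fix \<omega> assume w: "\<omega> \<in> G \<and> n \<bullet> U \<omega> \<noteq> n \<bullet> U \<omega>0"
    have "U \<omega> \<noteq> U \<omega>0" "U \<omega> \<noteq> U \<omega>1" using w n(2) by (auto simp: inner_diff_right)
    then obtain r s where r: "V \<omega> - V \<omega>0 = r *\<^sub>R (U \<omega> - U \<omega>0)" and s: "V \<omega> - V \<omega>1 = s *\<^sub>R (U \<omega> - U \<omega>1)"
      using par w w0 w1(1) by blast
    have "r *\<^sub>R (U \<omega> - U \<omega>0) - s *\<^sub>R (U \<omega> - U \<omega>1) = c *\<^sub>R (U \<omega>1 - U \<omega>0)"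
      unfolding r[symmetric] s[symmetric] c(2)[symmetric] by simp
    then have eq: "(r - s) *\<^sub>R (U \<omega> - U \<omega>0) = (c - s) *\<^sub>R (U \<omega>1 - U \<omega>0)"
      by (simp add: algebra_simps)
    \<comment> \<open>Pairing with \<open>n\<close> removes the right-hand side of
      \<open>eq\<close>, leaving a nonzero multiple of \<open>r - s\<close>.\<close>
    have "(r - s) * (n \<bullet> (U \<omega> - U \<omega>0)) = n \<bullet> ((r - s) *\<^sub>R (U \<omega> - U \<omega>0))" by simp
    also have "\<dots> = 0" unfolding eq using n(2) by simp
    finally have "r = s" using w by (simp add: inner_diff_right)
    then have "c = r" using eq ne by simp
    then show "V \<omega> = c *\<^sub>R U \<omega> + (V \<omega>0 - c *\<^sub>R U \<omega>0)" using r by (simp add: algebra_simps)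
  qed
  with c(1) show thesis by (rule that)
qed

lemma max_correlation_representation:
  "strongly_coherent M \<rho> \<and>
    (\<exists>\<nu>\<in>P2. (\<forall>X\<in>L2 M. ereal (\<rho> X) = max_correlation M \<nu> X) \<and>
       (2 \<le> DIM('b) \<and> \<not> expectation_functional M \<rho> \<longrightarrow>
          (\<exists>c>0. \<exists>u0. \<nu> = distr \<mu> borel (\<lambda>u. c *\<^sub>R u + u0))))"
proof -
  obtain V where V: "V \<in> L2 M" and dom: "\<And>X. X \<in> L2 M \<Longrightarrow> correlation M X V \<le> \<rho> X"
    and exact: "\<And>k. k \<in> optimal_cone \<Longrightarrow> correlation M k V = \<rho> k"
    using rho_subgradient by blast
  have [measurable]: "U \<in> borel_measurable M" "V \<in> borel_measurable M"
    using U_L2 V by (auto intro: L2_borel)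
  have "\<exists>c>0. \<exists>u0. distr M borel V = distr \<mu> borel (\<lambda>u. c *\<^sub>R u + u0)"
    if dim: "2 \<le> DIM('b)" and ne: "\<not> expectation_functional M \<rho>"
  proof -
    obtain c u0 where c: "0 \<le> c" and VU: "AE \<omega> in M. V \<omega> = c *\<^sub>R U \<omega> + u0"
      using AE_location_scale[OF V dom exact dim] by blast
    \<comment> \<open>A zero factor makes \<open>V\<close> almost surely constant, and
      \<open>\<rho>\<close> would be an expectation functional.\<close>
    have "c \<noteq> 0"
    proof
      assume c0: "c = 0"
      have corr: "correlation M X V = (\<integral>\<omega>. X \<omega> \<bullet> u0 \<partial>M)" if X: "X \<in> L2 M" for X
      proof -
        have [measurable]: "X \<in> borel_measurable M" using X by (rule L2_borel)
        show ?thesis unfolding correlation_def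
          by (rule integral_cong_AE) (use VU c0 in auto)
      qed
      have "\<rho> X = (\<integral>\<omega>. X \<omega> \<bullet> u0 \<partial>M)" if X: "X \<in> L2 M" for X
      proof (rule antisym)
        show "(\<integral>\<omega>. X \<omega> \<bullet> u0 \<partial>M) \<le> \<rho> X" using dom[OF X] corr[OF X] by simp
        show "\<rho> X \<le> (\<integral>\<omega>. X \<omega> \<bullet> u0 \<partial>M)"
        proof (rule field_le_epsilon)
          \<comment> \<open>Some rearrangement of \<open>X\<close> nearly attains
            \<open>\<rho> X\<close> against \<open>V\<close>, and its correlation with a constant
            depends on its law alone.\<close>
          fix e :: real assume e: "0 < e"
          obtain Y where Y: "same_law M Y X" "\<rho> X - e \<le> correlation M Y V"
            using rho_lower_approx_same_law[OF V exact X e] by blast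
          have "correlation M Y V = (\<integral>\<omega>. Y \<omega> \<bullet> u0 \<partial>M)"
            using X same_law_L2[OF same_law_sym[OF Y(1)]] by (intro corr) simp
          also have "\<dots> = (\<integral>\<omega>. X \<omega> \<bullet> u0 \<partial>M)"
            by (rule same_law_integral(1)[OF Y(1), of "\<lambda>x. x \<bullet> u0"]) measurable
          finally show "\<rho> X \<le> (\<integral>\<omega>. X \<omega> \<bullet> u0 \<partial>M) + e" using Y(2) by simp
        qed
      qed
      then show False using ne by (auto simp: expectation_functional_def)
    qed
    moreover have "distr M borel V = distr \<mu> borel (\<lambda>u. c *\<^sub>R u + u0)"
    proof -
      have "distr M borel V = distr M borel (\<lambda>\<omega>. c *\<^sub>R U \<omega> + u0)"
        by (rule distr_cong_AE) (use VU in auto)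
      also have "\<dots> = distr (distr M borel U) borel (\<lambda>u. c *\<^sub>R u + u0)"
        by (subst distr_distr) (auto simp: comp_def)
      finally show ?thesis using U by (simp add: has_law_def)
    qed
    ultimately show ?thesis using c by (intro exI[of _ c]) auto
  qed
  moreover have "strongly_coherent M \<rho>" by (rule rho_strongly_coherent[OF V dom exact])
  moreover have "\<forall>X\<in>L2 M. ereal (\<rho> X) = max_correlation M (distr M borel V) X"
    using rho_eq_max_correlation[OF V dom exact] by simp
  ultimately show ?thesis using distr_L2_P2[OF V] by blast
qed

end

lemma hyperplane_null_if_absolutely_continuous:
  fixes \<mu> :: "'b::euclidean_space measure"
  assumes ac: "absolutely_continuous lborel \<mu>" and a: "a \<noteq> 0"
  shows "{u. a \<bullet> u = b} \<in> null_sets \<mu>"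
proof -
  have "{u. a \<bullet> u = b} \<in> null_sets lebesgue"
    using negligible_hyperplane[of a b] a by (simp add: negligible_iff_null_sets)
  then have "{u. a \<bullet> u = b} \<in> null_sets lborel"
    by (subst (asm) null_sets_completion_iff) auto
  then show ?thesis using ac by (auto simp: absolutely_continuous_def)
qed

theorem theorem2:
  fixes M :: "'w measure"
    and \<mu> :: "(real ^ 'n) measure"
    and \<rho> :: "('w \<Rightarrow> real ^ 'n) \<Rightarrow> real"
  assumes "prob_space M" and "nonatomic M" and "L2_separable M"
    and "\<mu> \<in> P2" and "absolutely_continuous lborel \<mu>"
    and "lsc_functional M \<rho>" and "convex_functional M \<rho>"
    and "law_invariant M \<rho>" and "comonotonic_additive M \<mu> \<rho>"
  shows "strongly_coherent M \<rho> \<and>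
    (\<exists>\<nu>\<in>P2. (\<forall>X\<in>L2 M. ereal (\<rho> X) = max_correlation M \<nu> X) \<and>
       (2 \<le> CARD('n) \<and> \<not> expectation_functional M \<rho> \<longrightarrow>
          (\<exists>c>0. \<exists>u0. \<nu> = distr \<mu> borel (\<lambda>u. c *\<^sub>R u + u0))))"
proof -
  interpret prob_space M by fact
  have \<mu>: "prob_space \<mu>" "sets \<mu> = sets borel" using assms(4) by (auto simp: P2_def)
  obtain U :: "'w \<Rightarrow> real ^ 'n" where U: "has_law M U \<mu>"
    using nonatomic_ex_has_law[OF assms(2) \<mu>] by blast
  interpret comonotonic_risk_measure M \<mu> \<rho> U
    using assms U hyperplane_null_if_absolutely_continuous[OF assms(5)] by unfold_locales
  show ?thesis using max_correlation_representation by simp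
qed

end
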